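(* For every integer $n\ge 1$, the following polynomial identities hold: $$2(1+x)^{n-1}A_n(x)=\sum_{k=0}^n\binom{n}{k}T_k(x)T_{n-k}(x),$$ $$T_{n+1}(x)=x\sum_{k=0}^n\binom{n}{k}T_k(x)B_{n-k}(x^2),$$ $$T_{n+1}(x)=x\sum_{k=0}^n\binom{n}{k}S_k(x)N_{n-k}(x^2).$$
   Context: Polynomials $T_n$: let $\vartheta=x\frac{d}{dx}$ and $r(x)=\frac{\sqrt{1+x}}{\sqrt{1-x}}$. For $n\ge 1$ there are (uniquely determined) positive integers $T(n,k)$, $1\le k\le 2n-1$, such that $$\vartheta^n(r(x))=\frac{\sum_{k=1}^{2n-1}T(n,k)x^k}{(1-x)^n(1+x)^{n-1}\sqrt{1-x^2}}.$$ Put $T_n(x)=\sum_{k=1}^{2n-1}T(n,k)x^k$ for $n\ge1$ and $T_0(x)=1$. Eulerian polynomials: $A_n(x)=\sum_{\pi\in\mathfrak{S}_n}x^{\mathrm{des}(\pi)+1}$ for $n\ge 1$, where $\mathfrak{S}_n$ is the symmetric group on $\{1,\ldots,n\}$ and $\mathrm{des}(\pi)=\#\{i\in\{1,\ldots,n-1\}\mid \pi(i)>\pi(i+1)\}$. Polynomials $B_n$ and $S_n$: the hyperoctahedral group $B_n$ is the group of permutations $\pi$ of $\{\pm1,\ldots,\pm n\}$ with $\pi(-i)=-\pi(i)$ for all $i$. For $\pi\in B_n$ set $\pi(0)=0$ and $\mathrm{des}_A(\pi)=\#\{i\in\{1,\ldots,n-1\}\mid \pi(i)>\pi(i+1)\}$,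 $\mathrm{des}_B(\pi)=\#\{i\in\{0,1,\ldots,n-1\}\mid \pi(i)>\pi(i+1)\}$. The flag descent number is $\mathrm{fdes}(\pi)=2\,\mathrm{des}_A(\pi)+1$ if $\pi(1)<0$, and $\mathrm{fdes}(\pi)=2\,\mathrm{des}_A(\pi)$ otherwise. For $n\ge1$, $B_n(x)=\sum_{\pi\in B_n}x^{\mathrm{des}_B(\pi)}$ and $S_n(x)=\sum_{\pi\in B_n}x^{\mathrm{fdes}(\pi)}$; by convention $B_0(x)=S_0(x)=1$. Polynomials $N_n$: a Stirling permutation of order $n$ is a permutation $\sigma=\sigma(1)\cdots\sigma(2n)$ of the multiset $\{1,1,2,2,\ldots,n,n\}$ such that for each $i$, $1\le i\le n$, all entries between the two occurrences of $i$ are larger than $i$; $\mathcal{Q}_n$ is the set of these. $\Phi:\mathcal{Q}_n\to\mathfrak{S}_{2n}$ replaces, for each $j\in\{1,\ldots,n\}$, the first occurrence of $j$ in $\sigma$ by $2j$ and the second by $2j-1$; $\Phi(\mathcal{Q}_n)$ is its image. For $\pi\in\mathfrak{S}_m$, a left peak is an index $i\in\{1,\ldots,m-1\}$ with $\pi(i-1)<\pi(i)>\pi(i+1)$, where $\pi(0)=0$; $\mathrm{lpk}(\pi)$ is the number of left peaks. For $n\ge1$, $N_n(x)=\sum_{\pi\in\Phi(\mathcal{Q}_n)}x^{\mathrm{lpk}(\pi)}$, and $N_0(x)=1$. *)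

theory Defs
  imports
    "HOL-Analysis.Analysis"
    "HOL-Computational_Algebra.Polynomial"
    "HOL-Combinatorics.Multiset_Permutations"
begin

definition theta :: "(real \<Rightarrow> real) \<Rightarrow> real \<Rightarrow> real" where
  "theta f = (\<lambda>x. x * deriv f x)"

definition r_fun :: "real \<Rightarrow> real" where
  "r_fun x = sqrt (1 + x) / sqrt (1 - x)"

text \<open>
  The function \<open>r_fun\<close> is considered on the open interval from -1 to 1, where it is smooth.
  The coefficient family is set to 0 outside the index range, which makes it
  unique as a total function.
\<close>

definition is_T_coeffs :: "nat \<Rightarrow> (nat \<Rightarrow> int) \<Rightarrow> bool" where
  "is_T_coeffs n c \<longleftrightarrow>
     (\<forall>k\<in>{1..2*n-1}. c k > 0) \<and>
     (\<forall>k. k \<notin> {1..2*n-1} \<longrightarrow> c k = 0) \<and>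
     (\<forall>x\<in>{-1<..<1}. (theta ^^ n) r_fun x =
        (\<Sum>k=1..2*n-1. of_int (c k) * x ^ k) /
        ((1 - x) ^ n * (1 + x) ^ (n - 1) * sqrt (1 - x\<^sup>2)))"

definition T_coeff :: "nat \<Rightarrow> nat \<Rightarrow> int" where
  "T_coeff n = (THE c. is_T_coeffs n c)"

definition T_poly :: "nat \<Rightarrow> int poly" where
  "T_poly n = (if n = 0 then 1 else (\<Sum>k=1..2*n-1. monom (T_coeff n k) k))"

definition des :: "nat \<Rightarrow> (nat \<Rightarrow> nat) \<Rightarrow> nat" where
  "des n \<pi> = card {i\<in>{1..n-1}. \<pi> i > \<pi> (i + 1)}"

text \<open>Only used for \<open>n \<ge> 1\<close>.\<close>

definition eulerian_poly :: "nat \<Rightarrow> int poly" where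
  "eulerian_poly n = (\<Sum>\<pi> | \<pi> permutes {1..n}. monom 1 (des n \<pi> + 1))"

text \<open>
  Since 0 lies outside the permuted set, \<open>permutes\<close> already provides the
  convention \<open>\<pi> 0 = 0\<close>, both here and for ordinary permutations of \<open>{1..m}\<close>.
\<close>

definition signed_perms :: "nat \<Rightarrow> (int \<Rightarrow> int) set" where
  "signed_perms n =
     {\<pi>. \<pi> permutes ({- int n..int n} - {0}) \<and> (\<forall>i. \<pi> (- i) = - \<pi> i)}"

definition des_A :: "nat \<Rightarrow> (int \<Rightarrow> int) \<Rightarrow> nat" where
  "des_A n \<pi> = card {i\<in>{1..int n - 1}. \<pi> i > \<pi> (i + 1)}"

definition des_B :: "nat \<Rightarrow> (int \<Rightarrow> int) \<Rightarrow> nat" where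
  "des_B n \<pi> = card {i\<in>{0..int n - 1}. \<pi> i > \<pi> (i + 1)}"

definition fdes :: "nat \<Rightarrow> (int \<Rightarrow> int) \<Rightarrow> nat" where
  "fdes n \<pi> = (if \<pi> 1 < 0 then 2 * des_A n \<pi> + 1 else 2 * des_A n \<pi>)"

definition B_poly :: "nat \<Rightarrow> int poly" where
  "B_poly n = (if n = 0 then 1 else (\<Sum>\<pi>\<in>signed_perms n. monom 1 (des_B n \<pi>)))"

definition S_poly :: "nat \<Rightarrow> int poly" where
  "S_poly n = (if n = 0 then 1 else (\<Sum>\<pi>\<in>signed_perms n. monom 1 (fdes n \<pi>)))"

definition stirling_perms :: "nat \<Rightarrow> nat list set" where
  "stirling_perms n =
     {\<sigma> \<in> permutations_of_multiset (mset_set {1..n} + mset_set {1..n}).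
        \<forall>p q s. p < q \<and> q < s \<and> s < length \<sigma> \<and> \<sigma> ! p = \<sigma> ! s \<longrightarrow> \<sigma> ! q > \<sigma> ! p}"

text \<open>
  Words are lists with positions from 0, permutations are functions on \<open>{1..2*n}\<close>
  (identity elsewhere), so position \<open>i\<close> of the permutation is list index \<open>i - 1\<close>.
  An entry is a second occurrence iff it already occurs in the prefix before it.
\<close>

definition Phi :: "nat list \<Rightarrow> nat \<Rightarrow> nat" where
  "Phi \<sigma> i =
     (if i \<in> {1..length \<sigma>}
      then if \<sigma> ! (i - 1) \<in> set (take (i - 1) \<sigma>)
           then 2 * \<sigma> ! (i - 1) - 1
           else 2 * \<sigma> ! (i - 1)
      else i)"

definition lpk :: "nat \<Rightarrow> (nat \<Rightarrow> nat) \<Rightarrow> nat" where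
  "lpk m \<pi> = card {i\<in>{1..m-1}. \<pi> (i - 1) < \<pi> i \<and> \<pi> i > \<pi> (i + 1)}"

definition N_poly :: "nat \<Rightarrow> int poly" where
  "N_poly n = (if n = 0 then 1 else (\<Sum>\<pi>\<in>Phi ` stirling_perms n. monom 1 (lpk (2 * n) \<pi>)))"

end

theory Submission
  imports Defs "HOL-Library.Sublist"
begin

text \<open>
  Write \<open>\<theta> = x d/dx\<close>.  If \<open>\<theta> w = a * w / (1 - x\<^sup>2)\<close> for a function \<open>w\<close> and a polynomial \<open>a\<close>, then
  \<open>\<theta>\<close> applied \<open>n\<close> times to \<open>w\<close> is \<open>w * f n / (1 - x\<^sup>2) ^ n\<close> for polynomials \<open>f n\<close> with \<open>f 0 = 1\<close> and
  \<open>f (n + 1) = (a + 2 n x\<^sup>2) f n + x (1 - x\<^sup>2) (f n)'\<close>.  The predicate \<open>theta_numerators a f\<close>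
  states this recurrence together with \<open>f 0 = 1\<close>, so \<open>a\<close> determines the sequence \<open>f\<close>.  For a product
  of two functions \<open>w\<close> the polynomials \<open>a\<close> add up, because \<open>a / (1 - x\<^sup>2)\<close> is a logarithmic
  derivative, and by the Leibniz rule the numerators of the product are the binomial convolution
  of those of the factors (\<open>theta_numerators_convolution\<close>).

  Every family in the theorem is of this kind:
  \<^item> \<open>T\<^sub>n\<close> with \<open>w = sqrt ((1 + x) / (1 - x))\<close> and \<open>a = x\<close>;
  \<^item> \<open>B\<^sub>n(x\<^sup>2)\<close> with \<open>w = x / (1 - x\<^sup>2)\<close> and \<open>a = 1 + x\<^sup>2\<close>;
  \<^item> \<open>S\<^sub>n\<close> with \<open>w = x / (1 - x)\<close> and \<open>a = 1 + x\<close>;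
  \<^item> \<open>N\<^sub>n(x\<^sup>2)\<close> with \<open>w = 1 / sqrt (1 - x\<^sup>2)\<close> and \<open>a = x\<^sup>2\<close>;
  \<^item> \<open>2 (1 + x) ^ (n - 1) A\<^sub>n\<close> for positive \<open>n\<close> and \<open>1\<close> for \<open>n = 0\<close>, with
    \<open>w = (1 + x) / (1 - x)\<close> and \<open>a = 2 x\<close>;
  \<^item> \<open>T\<^sub>n\<^sub>+\<^sub>1 / x\<close> with \<open>w = x / ((1 - x) * sqrt (1 - x\<^sup>2))\<close> and \<open>a = 1 + x + x\<^sup>2\<close>.

  The three identities now follow from \<open>2 x = x + x\<close> and
  \<open>1 + x + x\<^sup>2 = x + (1 + x\<^sup>2) = (1 + x) + x\<^sup>2\<close>.

  Apart from \<open>T\<^sub>n\<close> the argument is purely algebraic.  The recurrences for \<open>A\<^sub>n\<close>, \<open>B\<^sub>n\<close>, \<open>S\<^sub>n\<close> and \<open>N\<^sub>n\<close>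
  hold because every object of order \<open>n + 1\<close> arises in exactly one way by inserting the largest
  letters into a gap of the word of an object of order \<open>n\<close>, and the number of gaps with a given
  effect on the statistic depends only on the value of the statistic and on \<open>n\<close>.  For \<open>T\<^sub>n\<close> the
  recurrence is obtained by differentiating on the interval from -1 to 1.  It yields a coefficient
  sequence with the defining properties, and a polynomial is determined by its values there.
\<close>

section \<open>Numerators of iterated derivatives\<close>

definition X :: "int poly" where
  "X = [:0, 1:]"

text \<open>
  The derivation \<open>(1 - x\<^sup>2) \<theta>\<close>.  The factor \<open>1 - x\<^sup>2\<close> clears the denominator that one further
  application of \<open>\<theta>\<close> produces.
\<close>

definition euler_poly_op :: "int poly \<Rightarrow> int poly" where
  "euler_poly_op p = X * (1 - X\<^sup>2) * pderiv p"

definition theta_numerators :: "int poly \<Rightarrow> (nat \<Rightarrow> int poly) \<Rightarrow> bool" where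
  "theta_numerators a f \<longleftrightarrow>
     f 0 = 1 \<and> (\<forall>n. f (Suc n) = (a + of_nat (2 * n) * X\<^sup>2) * f n + euler_poly_op (f n))"

lemma pderiv_X [simp]: "pderiv X = 1"
  by (simp add: X_def pderiv_pCons)

lemma X_power: "X ^ k = monom 1 k"
  by (simp add: X_def monom_altdef)

lemma euler_poly_op_1 [simp]: "euler_poly_op 1 = 0"
  by (simp add: euler_poly_op_def)

lemma euler_poly_op_mult:
  "euler_poly_op (p * q) = euler_poly_op p * q + p * euler_poly_op q"
  by (simp add: euler_poly_op_def pderiv_mult algebra_simps)

lemma euler_poly_op_of_nat_mult:
  "euler_poly_op (of_nat m * p) = of_nat m * euler_poly_op p"
  by (simp add: euler_poly_op_def pderiv_mult)

lemma euler_poly_op_sum: "euler_poly_op (\<Sum>i\<in>A. f i) = (\<Sum>i\<in>A. euler_poly_op (f i))"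
  unfolding euler_poly_op_def by (simp add: higher_pderiv_sum[where n=1, simplified] sum_distrib_left)

lemma X_mult_pderiv_X_power: "X * pderiv (X ^ k) = of_nat k * X ^ k"
proof (cases k)
  case (Suc j)
  then show ?thesis
    by (simp add: pderiv_power_Suc of_nat_poly del: of_nat_Suc power_Suc) simp
qed simp

lemma euler_poly_op_X_power: "euler_poly_op (X ^ k) = of_nat k * (X ^ k - X ^ (k + 2))"
proof -
  have "euler_poly_op (X ^ k) = (1 - X\<^sup>2) * (X * pderiv (X ^ k))"
    by (simp add: euler_poly_op_def algebra_simps)
  then show ?thesis
    by (simp only: X_mult_pderiv_X_power) (simp add: algebra_simps power_add power2_eq_square)
qed

lemma theta_numerators_unique:
  assumes "theta_numerators a f" "theta_numerators a g"
  shows "f n = g n"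
  using assms by (induction n) (simp_all add: theta_numerators_def)

text \<open>
  The combinatorial part of the Leibniz rule: Pascal's rule splits each binomial coefficient, and
  the two halves go to the terms in which the first or the second factor advances by one step.
\<close>

lemma binomial_convolution_Suc:
  fixes f g :: "nat \<Rightarrow> 'a::comm_semiring_1"
  shows "(\<Sum>k=0..Suc n. of_nat (Suc n choose k) * f k * g (Suc n - k)) =
         (\<Sum>k=0..n. of_nat (n choose k) * (f (Suc k) * g (n - k) + f k * g (Suc (n - k))))"
proof -
  have "(\<Sum>k=0..Suc n. of_nat (Suc n choose k) * f k * g (Suc n - k)) =
        f 0 * g (Suc n) + (\<Sum>k=0..n. of_nat (Suc n choose Suc k) * f (Suc k) * g (n - k))"
    by (subst sum.atLeast0_atMost_Suc_shift) simp
  also have "(\<Sum>k=0..n. of_nat (Suc n choose Suc k) * f (Suc k) * g (n - k)) =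
      (\<Sum>k=0..n. of_nat (n choose k) * f (Suc k) * g (n - k)) +
      (\<Sum>k=0..n. of_nat (n choose Suc k) * f (Suc k) * g (n - k))"
    by (simp add: algebra_simps sum.distrib)
  also have "f 0 * g (Suc n) + (\<dots>) =
      (\<Sum>k=0..n. of_nat (n choose k) * f (Suc k) * g (n - k)) +
      (\<Sum>k=0..Suc n. of_nat (n choose k) * f k * g (Suc n - k))"
    unfolding sum.atLeast0_atMost_Suc_shift[where n = n and g = "\<lambda>k. of_nat (n choose k) * f k * g (Suc n - k)"]
    by (simp add: algebra_simps)
  also have "(\<Sum>k=0..Suc n. of_nat (n choose k) * f k * g (Suc n - k)) =
      (\<Sum>k=0..n. of_nat (n choose k) * f k * g (Suc (n - k)))"
    by (simp add: Suc_diff_le binomial_eq_0)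
  finally show ?thesis
    by (simp add: algebra_simps sum.distrib)
qed

text \<open>
  The Leibniz rule for numerators.  In the term with index \<open>k\<close> the two recurrences contribute
  \<open>2 k x\<^sup>2\<close> and \<open>2 (n - k) x\<^sup>2\<close>; their sum does not depend on \<open>k\<close>, so it comes out of the sum.
\<close>

lemma theta_numerators_convolution:
  assumes f: "theta_numerators a f" and g: "theta_numerators b g"
  shows "theta_numerators (a + b) (\<lambda>n. \<Sum>k=0..n. of_nat (n choose k) * f k * g (n - k))"
proof -
  let ?h = "\<lambda>n. \<Sum>k=0..n. of_nat (n choose k) * f k * g (n - k)"
  have step: "f (Suc k) * g (n - k) + f k * g (Suc (n - k)) =
      (a + b + of_nat (2 * n) * X\<^sup>2) * (f k * g (n - k)) + euler_poly_op (f k * g (n - k))"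
    if "k \<le> n" for k n
  proof -
    have "(of_nat n :: int poly) = of_nat k + of_nat (n - k)"
      using that by (simp flip: of_nat_add)
    then show ?thesis
      using f g by (simp add: theta_numerators_def euler_poly_op_mult algebra_simps)
  qed
  have "?h (Suc n) = (a + b + of_nat (2 * n) * X\<^sup>2) * ?h n + euler_poly_op (?h n)" for n
  proof -
    have "?h (Suc n) = (\<Sum>k=0..n. of_nat (n choose k) *
        ((a + b + of_nat (2 * n) * X\<^sup>2) * (f k * g (n - k)) + euler_poly_op (f k * g (n - k))))"
      unfolding binomial_convolution_Suc by (intro sum.cong refl) (simp add: step)
    also have "\<dots> = (\<Sum>k=0..n.
        (a + b + of_nat (2 * n) * X\<^sup>2) * (of_nat (n choose k) * f k * g (n - k)) +
        euler_poly_op (of_nat (n choose k) * f k * g (n - k)))"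
      unfolding mult.assoc euler_poly_op_of_nat_mult by (intro sum.cong refl) (simp only: ac_simps distrib_left)
    also have "\<dots> = (a + b + of_nat (2 * n) * X\<^sup>2) * ?h n + euler_poly_op (?h n)"
      by (simp only: euler_poly_op_sum sum_distrib_left sum.distrib)
    finally show ?thesis .
  qed
  moreover have "?h 0 = 1"
    using f g by (simp add: theta_numerators_def)
  ultimately show ?thesis
    by (simp add: theta_numerators_def)
qed


section \<open>Words generated by insertion\<close>

definition insert_at :: "nat \<Rightarrow> 'a list \<Rightarrow> 'a list \<Rightarrow> 'a list" where
  "insert_at i b w = take i w @ b @ drop i w"

lemma insert_at_Nil [simp]: "insert_at i b [] = b"
  by (simp add: insert_at_def)

lemma insert_at_0 [simp]: "insert_at 0 b w = b @ w"
  by (simp add: insert_at_def)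

lemma insert_at_Suc [simp]: "insert_at (Suc i) b (x # w) = x # insert_at i b w"
  by (simp add: insert_at_def)

text \<open>
  A sequence of sets of words in which each step inserts one block of new letters into a gap.
  Since a block shares no letter with the old words, block, gap and old word can be read off from
  the result.
\<close>

definition insertion_family :: "(nat \<Rightarrow> 'a list set) \<Rightarrow> (nat \<Rightarrow> 'a list set) \<Rightarrow> bool" where
  "insertion_family W Bl \<longleftrightarrow> W 0 = {[]} \<and>
     (\<forall>n. W (Suc n) = {u @ b @ v |u v b. u @ v \<in> W n \<and> b \<in> Bl n}) \<and>
     (\<forall>n. finite (Bl n)) \<and>
     (\<forall>n. \<forall>b\<in>Bl n. b \<noteq> [] \<and> (\<forall>w\<in>W n. set b \<inter> set w = {}))"

lemma insertion_familyI:
  assumes "W 0 = {[]}"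
    and Suc: "\<And>n w. w \<in> W (Suc n) \<longleftrightarrow> (\<exists>u v b. w = u @ b @ v \<and> u @ v \<in> W n \<and> b \<in> Bl n)"
    and "\<And>n. finite (Bl n)" "\<And>n b. b \<in> Bl n \<Longrightarrow> b \<noteq> []"
    and "\<And>n b w. b \<in> Bl n \<Longrightarrow> w \<in> W n \<Longrightarrow> set b \<inter> set w = {}"
  shows "insertion_family W Bl"
proof -
  have "W (Suc n) = {u @ b @ v |u v b. u @ v \<in> W n \<and> b \<in> Bl n}" for n
    by (rule set_eqI) (simp only: Suc mem_Collect_eq)
  then show ?thesis
    using assms(1,3-5) unfolding insertion_family_def by (intro conjI allI ballI) simp_all
qed

lemma insertion_family_Suc_image:
  assumes "insertion_family W Bl"
  shows "W (Suc n) =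
    (\<lambda>(w, b, i). insert_at i b w) ` (SIGMA w:W n. SIGMA b:Bl n. {..length w})"
proof -
  have "W (Suc n) = {u @ b @ v |u v b. u @ v \<in> W n \<and> b \<in> Bl n}"
    using assms by (simp add: insertion_family_def)
  also have "\<dots> = (\<lambda>(w, b, i). insert_at i b w) ` (SIGMA w:W n. SIGMA b:Bl n. {..length w})"
  proof (intro set_eqI iffI)
    fix w assume "w \<in> {u @ b @ v |u v b. u @ v \<in> W n \<and> b \<in> Bl n}"
    then obtain u v b where "w = u @ b @ v" "u @ v \<in> W n" "b \<in> Bl n" by blast
    then show "w \<in> (\<lambda>(w, b, i). insert_at i b w) ` (SIGMA w:W n. SIGMA b:Bl n. {..length w})"
      by (intro image_eqI[where x = "(u @ v, b, length u)"]) (auto simp: insert_at_def)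
  next
    fix w assume "w \<in> (\<lambda>(w, b, i). insert_at i b w) ` (SIGMA w:W n. SIGMA b:Bl n. {..length w})"
    then obtain w' b i where "w = insert_at i b w'" "w' \<in> W n" "b \<in> Bl n" by auto
    then show "w \<in> {u @ b @ v |u v b. u @ v \<in> W n \<and> b \<in> Bl n}"
      unfolding insert_at_def by (metis (mono_tags, lifting) append_take_drop_id mem_Collect_eq)
  qed
  finally show ?thesis .
qed

lemma insertion_family_finite:
  assumes "insertion_family W Bl"
  shows "finite (W n)"
proof (induction n)
  case 0
  then show ?case using assms by (simp add: insertion_family_def)
next
  case (Suc n)
  then show ?case
    using assms unfolding insertion_family_Suc_image[OF assms]
    by (intro finite_imageI finite_SigmaI) (auto simp: insertion_family_def)
qed

text \<open>
  Deleting the new letters recovers the old word, keeping only them recovers the block, and the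
  letters in front of the first new one count the gap.
\<close>

lemma insert_at_recover:
  assumes "i \<le> length w" "b \<noteq> []" and old: "\<forall>x\<in>set w. \<not> P x" and new: "\<forall>x\<in>set b. P x"
  shows "filter (\<lambda>x. \<not> P x) (insert_at i b w) = w"
    and "filter P (insert_at i b w) = b"
    and "length (takeWhile (\<lambda>x. \<not> P x) (insert_at i b w)) = i"
proof -
  have old': "\<forall>x\<in>set (take i w). \<not> P x" "\<forall>x\<in>set (drop i w). \<not> P x"
    using old by (auto dest: in_set_takeD in_set_dropD)
  have none: "filter (\<lambda>x. \<not> P x) b = []" "filter P (take i w) = []" "filter P (drop i w) = []"
    using old' new by (simp_all add: filter_empty_conv)
  have all: "filter (\<lambda>x. \<not> P x) (take i w) = take i w" "filter (\<lambda>x. \<not> P x) (drop i w) = drop i w"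
    "filter P b = b"
    using old' new by (simp_all only: filter_id_conv)
  show "filter (\<lambda>x. \<not> P x) (insert_at i b w) = w" "filter P (insert_at i b w) = b"
    by (simp_all only: insert_at_def filter_append none all append_Nil append_Nil2 append_take_drop_id)
  have "takeWhile (\<lambda>x. \<not> P x) (insert_at i b w) = take i w"
    unfolding insert_at_def using old' new \<open>b \<noteq> []\<close>
    by (subst takeWhile_append2) (auto simp: neq_Nil_conv)
  then show "length (takeWhile (\<lambda>x. \<not> P x) (insert_at i b w)) = i"
    using \<open>i \<le> length w\<close> by simp
qed

lemma insertion_family_sum:
  assumes W: "insertion_family W Bl"
  shows "(\<Sum>w\<in>W (Suc n). F w) = (\<Sum>w\<in>W n. \<Sum>b\<in>Bl n. \<Sum>i\<le>length w. F (insert_at i b w))"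
proof -
  let ?S = "SIGMA w:W n. SIGMA b:Bl n. {..length w}"
  have inj: "inj_on (\<lambda>(w, b, i). insert_at i b w) ?S"
  proof (rule inj_onI)
    fix p q assume pq: "p \<in> ?S" "q \<in> ?S"
      "(\<lambda>(w, b, i). insert_at i b w) p = (\<lambda>(w, b, i). insert_at i b w) q"
    obtain w b i w' c j where p: "p = (w, b, i)" "q = (w', c, j)"
      by (metis surj_pair)
    have *: "w \<in> W n" "b \<in> Bl n" "i \<le> length w" "w' \<in> W n" "c \<in> Bl n" "j \<le> length w'"
      "insert_at i b w = insert_at j c w'"
      using pq by (auto simp: p)
    let ?P = "\<lambda>x. x \<in> set b \<union> set c"
    have "b \<noteq> []" "c \<noteq> []" "\<forall>x\<in>set w. \<not> ?P x" "\<forall>x\<in>set w'. \<not> ?P x"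
      using W * unfolding insertion_family_def by blast+
    moreover have "\<forall>x\<in>set b. ?P x" "\<forall>x\<in>set c. ?P x"
      by simp_all
    ultimately have "w = w' \<and> b = c \<and> i = j"
      using insert_at_recover[of i w b ?P] insert_at_recover[of j w' c ?P] *(3,6,7) by metis
    then show "p = q"
      by (simp add: p)
  qed
  have fin: "finite (W n)" "finite (Bl n)"
    using W insertion_family_finite[OF W] by (auto simp: insertion_family_def)
  have "(\<Sum>w\<in>W (Suc n). F w) = (\<Sum>(w, b, i)\<in>?S. F (insert_at i b w))"
    unfolding insertion_family_Suc_image[OF W] sum.reindex[OF inj]
    by (simp add: comp_def case_prod_unfold)
  also have "\<dots> = (\<Sum>w\<in>W n. \<Sum>b\<in>Bl n. \<Sum>i\<le>length w. F (insert_at i b w))"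
    using fin by (simp add: sum.Sigma)
  finally show ?thesis .
qed

lemma sum_insert_at_Cons:
  "(\<Sum>i\<le>length (x # w). F (insert_at i b (x # w))) =
     F (b @ x # w) + (\<Sum>i\<le>length w. F (x # insert_at i b w))"
  unfolding list.size add_Suc_right add_0_right
  by (subst sum.atMost_Suc_shift) simp

text \<open>
  Counts reduce to a statement about a single word.  The operator \<open>euler_poly_op\<close> maps \<open>X ^ s\<close> to
  \<open>s (X ^ s - X ^ (s + 2))\<close>; so the recurrence holds as soon as the insertions into one word
  produce the contribution of that word to the right-hand side.
\<close>

lemma theta_numerators_insertion:
  fixes s :: "'a list \<Rightarrow> nat"
  assumes W: "insertion_family W Bl"
    and nil: "s [] = 0"
    and gaps: "\<And>n w. w \<in> W n \<Longrightarrow>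
      (\<Sum>b\<in>Bl n. \<Sum>i\<le>length w. X ^ s (insert_at i b w)) =
      (a + of_nat (2 * n) * X\<^sup>2) * X ^ s w + of_nat (s w) * (X ^ s w - X ^ (s w + 2))"
  shows "theta_numerators a (\<lambda>n. \<Sum>w\<in>W n. X ^ s w)"
proof -
  have "(\<Sum>w\<in>W (Suc n). X ^ s w) =
      (a + of_nat (2 * n) * X\<^sup>2) * (\<Sum>w\<in>W n. X ^ s w) + euler_poly_op (\<Sum>w\<in>W n. X ^ s w)" for n
  proof -
    have "(\<Sum>w\<in>W (Suc n). X ^ s w) = (\<Sum>w\<in>W n.
        (a + of_nat (2 * n) * X\<^sup>2) * X ^ s w + of_nat (s w) * (X ^ s w - X ^ (s w + 2)))"
      unfolding insertion_family_sum[OF W] by (intro sum.cong refl gaps)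
    then show ?thesis
      by (simp only: euler_poly_op_sum euler_poly_op_X_power sum.distrib sum_distrib_left)
  qed
  moreover have "W 0 = {[]}"
    using W by (simp add: insertion_family_def)
  ultimately show ?thesis
    using nil by (simp add: theta_numerators_def)
qed

section \<open>Descents and the Eulerian polynomials\<close>

text \<open>
  The first argument is the letter in front of the word.  With \<open>0\<close> there, this is the number of
  type B descents; for words of positive letters it is the ordinary descent number.  Having it as
  an argument lets induction on the word move it forward.
\<close>

fun descents :: "'a::linorder \<Rightarrow> 'a list \<Rightarrow> nat" where
  "descents a [] = 0"
| "descents a (x # w) = (if a > x then 1 else 0) + descents x w"

lemma descents_eq_card: "descents a w = card {i \<in> {..<length w}. (a # w) ! i > w ! i}"
proof -
  have "descents a w = (\<Sum>i<length w. of_bool ((a # w) ! i > w ! i))"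
    by (induction w arbitrary: a) (simp_all add: sum.lessThan_Suc_shift del: sum.lessThan_Suc)
  then show ?thesis
    by (simp add: Int_def)
qed

text \<open>
  Inserting a letter larger than all others adds no descent if the gap is a descent or the end of
  the word, and adds one otherwise.
\<close>

lemma sum_descents_insert_max:
  fixes x :: "'b::comm_ring_1"
  assumes "a < m" "\<forall>y\<in>set w. y < m"
  shows "(\<Sum>i\<le>length w. x ^ descents a (insert_at i [m] w)) =
    of_nat (descents a w + 1) * x ^ descents a w +
    (of_nat (length w) - of_nat (descents a w)) * x ^ (descents a w + 1)"
  using assms
proof (induction w arbitrary: a)
  case (Cons y w)
  let ?e = "if a > y then 1 else 0 :: nat"
  have "(\<Sum>i\<le>length (y # w). x ^ descents a (insert_at i [m] (y # w))) =
      x ^ (1 + descents y w) + x ^ ?e * (\<Sum>i\<le>length w. x ^ descents y (insert_at i [m] w))"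
    using Cons.prems less_not_sym[OF Cons.prems(1)] unfolding sum_insert_at_Cons[where F = "\<lambda>v. x ^ descents a v"]
    by (simp add: power_add sum_distrib_left del: sum.atMost_Suc)
  also have "(\<Sum>i\<le>length w. x ^ descents y (insert_at i [m] w)) =
      of_nat (descents y w + 1) * x ^ descents y w +
      (of_nat (length w) - of_nat (descents y w)) * x ^ (descents y w + 1)"
    using Cons.prems by (intro Cons.IH) auto
  finally show ?case
    by (cases "a > y") (simp_all add: algebra_simps del: sum.atMost_Suc)
qed simp

text \<open>
  A gap between two letters behaves in the same way for the maximum and for the minimum: it adds no
  descent if the gap is a descent already, and one otherwise.  At the end of the word the maximum
  adds no descent and the minimum adds one.
\<close>

lemma sum_descents_insert_extremes:
  fixes x :: "'b::comm_ring_1"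
  assumes "l < a" "a < m" "\<forall>y\<in>set w. l < y \<and> y < m"
  shows "(\<Sum>i\<le>length w. x ^ descents a (insert_at i [m] w) + x ^ descents a (insert_at i [l] w)) =
    of_nat (2 * descents a w + 1) * x ^ descents a w +
    (of_nat (2 * length w + 1) - of_nat (2 * descents a w)) * x ^ (descents a w + 1)"
  using assms
proof (induction w arbitrary: a)
  case (Cons y w)
  let ?e = "if a > y then 1 else 0 :: nat"
  have "(\<Sum>i\<le>length (y # w). x ^ descents a (insert_at i [m] (y # w)) + x ^ descents a (insert_at i [l] (y # w))) =
      2 * x ^ (1 + descents y w) +
      x ^ ?e * (\<Sum>i\<le>length w. x ^ descents y (insert_at i [m] w) + x ^ descents y (insert_at i [l] w))"
    using Cons.prems less_not_sym[OF Cons.prems(1)] less_not_sym[OF Cons.prems(2)] less_not_sym[of l y] unfolding sum.distrib sum_insert_at_Cons[where F = "\<lambda>v. x ^ descents a v"]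
    by (simp add: power_add sum_distrib_left distrib_left)
  also have "(\<Sum>i\<le>length w. x ^ descents y (insert_at i [m] w) + x ^ descents y (insert_at i [l] w)) =
      of_nat (2 * descents y w + 1) * x ^ descents y w +
      (of_nat (2 * length w + 1) - of_nat (2 * descents y w)) * x ^ (descents y w + 1)"
    using Cons.prems by (intro Cons.IH) auto
  finally show ?case
    by (cases "a > y") (simp_all add: algebra_simps del: sum.atMost_Suc)
qed simp

definition perm_words :: "nat \<Rightarrow> nat list set" where
  "perm_words n = {w. distinct w \<and> set w = {1..n}}"

lemma perm_words_length: "w \<in> perm_words n \<Longrightarrow> length w = n"
  using distinct_card[of w] by (simp add: perm_words_def)

lemma insertion_family_perm_words: "insertion_family perm_words (\<lambda>n. {[Suc n]})"
proof (rule insertion_familyI)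
  fix n w
  have "w \<in> perm_words (Suc n) \<longleftrightarrow> (\<exists>u v. w = u @ [Suc n] @ v \<and> u @ v \<in> perm_words n)"
  proof
    assume w: "w \<in> perm_words (Suc n)"
    then have "Suc n \<in> set w"
      by (simp add: perm_words_def)
    then obtain u v where uv: "w = u @ Suc n # v"
      by (auto dest: split_list)
    have "Suc n \<notin> set (u @ v)" "insert (Suc n) (set (u @ v)) = insert (Suc n) {1..n}"
      using w by (auto simp: perm_words_def uv atLeastAtMostSuc_conv)
    moreover have "Suc n \<notin> {1..n}"
      by simp
    ultimately have "set (u @ v) = {1..n}"
      by (metis insert_ident)
    then show "\<exists>u v. w = u @ [Suc n] @ v \<and> u @ v \<in> perm_words n"
      using w uv by (intro exI[of _ u] exI[of _ v]) (simp add: perm_words_def)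
  next
    assume "\<exists>u v. w = u @ [Suc n] @ v \<and> u @ v \<in> perm_words n"
    then obtain u v where uv: "w = u @ Suc n # v" "distinct (u @ v)" "set u \<union> set v = {1..n}"
      by (auto simp: perm_words_def)
    have "x \<le> n" if "x \<in> set u \<union> set v" for x
      using that unfolding uv(3) by simp
    then have "Suc n \<notin> set u" "Suc n \<notin> set v"
      by force+
    then show "w \<in> perm_words (Suc n)"
      using uv by (auto simp: perm_words_def atLeastAtMostSuc_conv)
  qed
  then show "w \<in> perm_words (Suc n) \<longleftrightarrow> (\<exists>u v b. w = u @ b @ v \<and> u @ v \<in> perm_words n \<and> b \<in> {[Suc n]})"
    by blast
qed (auto simp: perm_words_def)

lemma bij_betw_perm_words:
  "bij_betw (\<lambda>\<pi>. map \<pi> [1..<Suc n]) {\<pi>. \<pi> permutes {1..n}} (perm_words n)"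
proof (rule bij_betwI')
  fix \<pi> \<sigma> :: "nat \<Rightarrow> nat"
  assume *: "\<pi> \<in> {\<pi>. \<pi> permutes {1..n}}" "\<sigma> \<in> {\<pi>. \<pi> permutes {1..n}}"
  show "map \<pi> [1..<Suc n] = map \<sigma> [1..<Suc n] \<longleftrightarrow> \<pi> = \<sigma>"
  proof
    assume "map \<pi> [1..<Suc n] = map \<sigma> [1..<Suc n]"
    then have "\<pi> i = \<sigma> i" if "i \<in> {1..n}" for i
      using that by (auto simp del: upt_Suc)
    then show "\<pi> = \<sigma>"
      using * by (metis ext mem_Collect_eq permutes_not_in)
  qed simp
next
  fix \<pi> :: "nat \<Rightarrow> nat"
  assume *: "\<pi> \<in> {\<pi>. \<pi> permutes {1..n}}"
  then have "inj_on \<pi> {1..n}" "\<pi> ` {1..n} = {1..n}"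
    by (auto simp: permutes_inj_on permutes_image)
  moreover have "set [1..<Suc n] = {1..n}"
    by auto
  ultimately show "map \<pi> [1..<Suc n] \<in> perm_words n"
    unfolding perm_words_def by (simp add: distinct_map del: upt_Suc set_upt)
next
  fix w assume w: "w \<in> perm_words n"
  define \<pi> where "\<pi> i = (if i \<in> {1..n} then w ! (i - 1) else i)" for i
  have word: "map \<pi> [1..<Suc n] = w"
    by (rule nth_equalityI) (use perm_words_length[OF w] in \<open>auto simp: \<pi>_def nth_append simp del: upt_Suc\<close>)
  have "set [1..<Suc n] = {1..n}"
    by auto
  then have "inj_on \<pi> {1..n}" "\<pi> ` {1..n} = {1..n}"
    using w word unfolding perm_words_def
    by (metis (mono_tags, lifting) distinct_map mem_Collect_eq, metis (mono_tags, lifting) list.set_map mem_Collect_eq)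
  then have "\<pi> permutes {1..n}"
    by (intro bij_imp_permutes) (auto simp: bij_betw_def \<pi>_def)
  then show "\<exists>\<pi>\<in>{\<pi>. \<pi> permutes {1..n}}. w = map \<pi> [1..<Suc n]"
    using word by auto
qed

lemma des_eq_descents:
  assumes "\<pi> permutes {1..n}"
  shows "des n \<pi> = descents 0 (map \<pi> [1..<Suc n])"
proof -
  define w where "w = map \<pi> [1..<Suc n]"
  have "\<pi> 0 = 0"
    using assms by (simp add: permutes_not_in)
  have len: "length w = n"
    by (simp add: w_def)
  have w: "w ! i = \<pi> (i + 1)" if "i < n" for i
    using that by (auto simp: w_def simp del: upt_Suc)
  then have w0: "(0 # w) ! i = \<pi> i" if "i < n" for i
    using that \<open>\<pi> 0 = 0\<close> by (cases i) auto
  have "{i \<in> {1..n - 1}. \<pi> i > \<pi> (i + 1)} = {i \<in> {..<n}. \<pi> i > \<pi> (i + 1)}"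
    using \<open>\<pi> 0 = 0\<close> by (auto simp: Suc_le_eq intro!: gr0I)
  also have "\<dots> = {i \<in> {..<length w}. (0 # w) ! i > w ! i}"
    by (rule Collect_cong) (auto simp: w w0 len)
  finally show ?thesis
    by (simp only: des_def descents_eq_card w_def)
qed

lemma eulerian_poly_eq_sum_words: "eulerian_poly n = X * (\<Sum>w\<in>perm_words n. X ^ descents 0 w)"
proof -
  have "eulerian_poly n = (\<Sum>\<pi> | \<pi> permutes {1..n}. X * X ^ descents 0 (map \<pi> [1..<Suc n]))"
    unfolding eulerian_poly_def
    by (intro sum.cong refl) (simp add: des_eq_descents flip: X_power del: upt_Suc)
  also have "\<dots> = (\<Sum>w\<in>perm_words n. X * X ^ descents 0 w)"
    by (rule sum.reindex_bij_betw[OF bij_betw_perm_words])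
  finally show ?thesis
    by (simp add: sum_distrib_left)
qed

text \<open>
  A permutation with \<open>d\<close> descents contributes \<open>x ^ (d + 1)\<close> to \<open>A\<^sub>n\<close>.  It has \<open>d + 1\<close> gaps where
  \<open>n + 1\<close> can be inserted without a new descent and \<open>n - d\<close> others, which are the coefficients on
  the right-hand side.
\<close>

lemma eulerian_poly_Suc:
  "eulerian_poly (Suc n) = X * (of_nat (Suc n) * eulerian_poly n + (1 - X) * pderiv (eulerian_poly n))"
proof -
  have step: "X * (of_nat (d + 1) * X ^ d + (of_nat n - of_nat d) * X ^ (d + 1)) =
      X * (of_nat (Suc n) * (X * X ^ d) + (1 - X) * pderiv (X * X ^ d))" for d
  proof -
    have "X * pderiv (X * X ^ d) = of_nat (d + 1) * X ^ (d + 1)"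
      using X_mult_pderiv_X_power[of "d + 1"] by simp
    moreover have "X * ((1 - X) * pderiv (X * X ^ d)) = (1 - X) * (X * pderiv (X * X ^ d))"
      by (rule mult.left_commute)
    ultimately show ?thesis
      unfolding distrib_left[of X "of_nat (Suc n) * (X * X ^ d)"] by (simp only:) (simp add: algebra_simps)
  qed
  have "eulerian_poly (Suc n) = (\<Sum>w\<in>perm_words n. X * (\<Sum>i\<le>n. X ^ descents 0 (insert_at i [Suc n] w)))"
    unfolding eulerian_poly_eq_sum_words insertion_family_sum[OF insertion_family_perm_words]
    by (simp add: sum_distrib_left perm_words_length)
  also have "\<dots> = (\<Sum>w\<in>perm_words n.
      X * (of_nat (Suc n) * (X * X ^ descents 0 w) + (1 - X) * pderiv (X * X ^ descents 0 w)))"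
  proof (intro sum.cong refl)
    fix w assume w: "w \<in> perm_words n"
    then have "\<forall>y\<in>set w. y < Suc n"
      by (auto simp: perm_words_def)
    then show "X * (\<Sum>i\<le>n. X ^ descents 0 (insert_at i [Suc n] w)) =
      X * (of_nat (Suc n) * (X * X ^ descents 0 w) + (1 - X) * pderiv (X * X ^ descents 0 w))"
      using sum_descents_insert_max[of 0 "Suc n" w X] perm_words_length[OF w] by (simp only: step)
  qed
  also have "\<dots> = X * (of_nat (Suc n) * eulerian_poly n + (1 - X) * pderiv (eulerian_poly n))"
    unfolding eulerian_poly_eq_sum_words sum_distrib_left
    by (simp add: sum.distrib sum_distrib_left distrib_left higher_pderiv_sum[where n=1, simplified])
  finally show ?thesis .
qed

lemma eulerian_poly_1: "eulerian_poly 1 = X"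
proof -
  have "{\<pi>. \<pi> permutes {Suc 0}} = {id}"
    by auto
  then show ?thesis
    by (simp add: eulerian_poly_def des_def flip: X_power)
qed

text \<open>
  The iterated derivative of \<open>1 / (1 - x)\<close> is \<open>A\<^sub>n / (1 - x) ^ (n + 1)\<close>, and the power of \<open>1 + x\<close>
  changes this denominator into \<open>(1 - x\<^sup>2) ^ n\<close> times \<open>(1 - x) / (1 + x)\<close>.  The value at \<open>0\<close> reflects that \<open>(1 + x) / (1 - x) = 2 / (1 - x) - 1\<close>: the constant
  \<open>-1\<close> contributes only as long as nothing has been differentiated.
\<close>

lemma theta_numerators_eulerian:
  "theta_numerators (2 * X) (\<lambda>n. if n = 0 then 1 else 2 * (1 + X) ^ (n - 1) * eulerian_poly n)"
proof -
  define f where "f n = (if n = 0 then 1 else 2 * (1 + X) ^ (n - 1) * eulerian_poly n)" for n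
  have f_0: "f 0 = 1" and f_Suc: "f (Suc n) = 2 * ((1 + X) ^ n * eulerian_poly (Suc n))" for n
    by (simp_all add: f_def mult.assoc)
  have base: "f (Suc 0) = (2 * X + of_nat (2 * 0) * X\<^sup>2) * f 0 + euler_poly_op (f 0)"
    using eulerian_poly_1 by (simp add: f_0 f_Suc)
  have step: "f (Suc (Suc n)) =
      (2 * X + of_nat (2 * Suc n) * X\<^sup>2) * f (Suc n) + euler_poly_op (f (Suc n))" for n
  proof -
    have two: "euler_poly_op (2 * p) = 2 * euler_poly_op p" for p
      using euler_poly_op_of_nat_mult[of 2 p] by simp
    have pow: "euler_poly_op ((1 + X) ^ n) = of_nat n * (X * (1 - X)) * (1 + X) ^ n"
    proof (cases n)
      case (Suc m)
      have "pderiv ((1 + X) ^ n) = of_nat n * (1 + X) ^ m"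
        unfolding Suc pderiv_power_Suc by (simp add: pderiv_add of_nat_poly del: of_nat_Suc)
      moreover have "X * (1 - X\<^sup>2) * (of_nat n * P) = of_nat n * (X * (1 - X)) * ((1 + X) * P)" for P
        by (simp add: algebra_simps power2_eq_square)
      ultimately show ?thesis
        by (simp only: euler_poly_op_def Suc power_Suc)
    qed simp
    have eul: "euler_poly_op (eulerian_poly (Suc n)) =
        (1 + X) * (X * ((1 - X) * pderiv (eulerian_poly (Suc n))))"
      by (simp add: euler_poly_op_def algebra_simps power2_eq_square)
    have ring: "2 * ((1 + x) * P * (x * ((N + 2) * E + (1 - x) * E'))) =
        (2 * x + 2 * (N + 1) * x\<^sup>2) * (2 * (P * E)) +
        2 * (N * (x * (1 - x)) * P * E + P * ((1 + x) * (x * ((1 - x) * E'))))"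
      for x P N E E' :: "int poly"
      by (simp add: algebra_simps power2_eq_square)
    show ?thesis
      unfolding f_Suc two unfolding euler_poly_op_mult pow eul eulerian_poly_Suc[of "Suc n"] power_Suc
      using ring[of X "(1 + X) ^ n" "of_nat n"] by (simp add: add.commute)
  qed
  have "f (Suc n) = (2 * X + of_nat (2 * n) * X\<^sup>2) * f n + euler_poly_op (f n)" for n
    using base step by (cases n) simp_all
  then have "theta_numerators (2 * X) f"
    by (simp only: theta_numerators_def f_0 simp_thms)
  then show ?thesis
    by (simp only: f_def[abs_def])
qed

section \<open>Signed permutations\<close>

text \<open>
  The flag descent number in terms of the window notation of a signed permutation: the descents
  among the letters count twice, and a negative first letter counts once.
\<close>

fun flag_descents :: "int list \<Rightarrow> nat" where
  "flag_descents [] = 0"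
| "flag_descents (x # w) = (if x < 0 then 1 else 0) + 2 * descents x w"

text \<open>
  Away from the front, \<open>sum_descents_insert_extremes\<close> applies with the first letter in the role of
  the letter in front.  At the front, the larger new letter always gives a descent and a
  nonnegative first letter, whereas the smaller one gives a negative first letter and no descent.
  Together the two front insertions make up for the sign of the old first letter, so that exactly
  one insertion in total raises the statistic by one.
\<close>

lemma sum_flag_descents_insert_extremes:
  fixes x :: "'b::comm_ring_1"
  assumes "l < 0" "0 < m" "\<forall>y\<in>set w. l < y \<and> y < m"
  shows "(\<Sum>i\<le>length w. x ^ flag_descents (insert_at i [m] w) + x ^ flag_descents (insert_at i [l] w)) =
    of_nat (flag_descents w + 1) * x ^ flag_descents w + x ^ (flag_descents w + 1) +
    (of_nat (2 * length w) - of_nat (flag_descents w)) * x ^ (flag_descents w + 2)"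
proof (cases w)
  case Nil
  then show ?thesis
    using assms by simp
next
  case (Cons y v)
  let ?e = "if y < 0 then 1 else 0 :: nat" and ?d = "descents y v"
  have y: "l < y" "y < m" "\<not> y < l" "\<not> m < y" "\<not> m < 0" and v: "\<forall>z\<in>set v. l < z \<and> z < m"
    using assms Cons by auto
  have "(\<Sum>i\<le>length (y # v). x ^ flag_descents (insert_at i [m] (y # v)) +
        x ^ flag_descents (insert_at i [l] (y # v))) =
      x ^ (2 * (1 + ?d)) + x ^ (1 + 2 * ?d) +
      x ^ ?e * (\<Sum>i\<le>length v. (x\<^sup>2) ^ descents y (insert_at i [m] v) + (x\<^sup>2) ^ descents y (insert_at i [l] v))"
    using assms(1) y unfolding sum.distrib sum_insert_at_Cons[where F = "\<lambda>v. x ^ flag_descents v"]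
    by (simp add: power_add sum_distrib_left distrib_left power_mult)
  also have "\<dots> = x ^ (2 * (1 + ?d)) + x ^ (1 + 2 * ?d) +
      x ^ ?e * (of_nat (2 * ?d + 1) * (x\<^sup>2) ^ ?d +
        (of_nat (2 * length v + 1) - of_nat (2 * ?d)) * (x\<^sup>2) ^ (?d + 1))"
    using y v by (simp only: sum_descents_insert_extremes)
  also have "\<dots> = x ^ (2 * (1 + ?d)) + x ^ (1 + 2 * ?d) +
      x ^ ?e * (of_nat (2 * ?d + 1) * x ^ (2 * ?d) +
        (of_nat (2 * length v + 1) - of_nat (2 * ?d)) * x ^ (2 * (?d + 1)))"
    by (simp only: power_mult)
  finally show ?thesis
    unfolding Cons by (cases "y < 0")
      (simp_all add: algebra_simps power_add power2_eq_square del: sum.atMost_Suc)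
qed

definition signed_words :: "nat \<Rightarrow> int list set" where
  "signed_words n = {w. distinct (map abs w) \<and> abs ` set w = {1..int n}}"

lemma signed_words_length: "w \<in> signed_words n \<Longrightarrow> length w = n"
  using distinct_card[of "map abs w"] by (simp add: signed_words_def)

lemma insertion_family_signed_words:
  "insertion_family signed_words (\<lambda>n. {[int n + 1], [- (int n + 1)]})"
proof (rule insertion_familyI)
  fix n w
  let ?Bl = "\<lambda>n. {[int n + 1], [- (int n + 1)]}"
  show "w \<in> signed_words (Suc n) \<longleftrightarrow> (\<exists>u v b. w = u @ b @ v \<and> u @ v \<in> signed_words n \<and> b \<in> ?Bl n)"
  proof
    assume w: "w \<in> signed_words (Suc n)"
    then have "int n + 1 \<in> abs ` set w"
      by (simp add: signed_words_def)
    then obtain x where "x \<in> set w" and x: "\<bar>x\<bar> = int n + 1"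
      by auto
    then obtain u v where uv: "w = u @ x # v"
      by (auto dest: split_list)
    have "{1..int (Suc n)} = insert (int n + 1) {1..int n}"
      by auto
    then have "int n + 1 \<notin> abs ` set (u @ v)"
      "insert (int n + 1) (abs ` set (u @ v)) = insert (int n + 1) {1..int n}"
      using w x by (auto simp: signed_words_def uv)
    moreover have "int n + 1 \<notin> {1..int n}"
      by simp
    ultimately have "abs ` set (u @ v) = {1..int n}"
      by (metis insert_ident)
    moreover have "[x] \<in> ?Bl n"
      using x by auto
    ultimately show "\<exists>u v b. w = u @ b @ v \<and> u @ v \<in> signed_words n \<and> b \<in> ?Bl n"
      using w uv by (intro exI[of _ u] exI[of _ v] exI[of _ "[x]"]) (simp add: signed_words_def)
  next
    assume "\<exists>u v b. w = u @ b @ v \<and> u @ v \<in> signed_words n \<and> b \<in> ?Bl n"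
    then obtain u v b where "w = u @ b @ v" "u @ v \<in> signed_words n" and b: "b \<in> ?Bl n"
      by blast
    moreover from b obtain x where "b = [x]" and x: "\<bar>x\<bar> = int n + 1"
      by force
    ultimately have uv: "w = u @ x # v" "distinct (map abs (u @ v))" "abs ` set (u @ v) = {1..int n}"
      by (simp_all add: signed_words_def)
    have "y \<le> int n" if "y \<in> abs ` set (u @ v)" for y
      using that unfolding uv(3) by simp
    then have "\<bar>x\<bar> \<notin> abs ` set (u @ v)"
      using x by force
    moreover have "abs ` set w = insert (int n + 1) {1..int n}"
      using uv(3) x by (auto simp: uv(1))
    then have "abs ` set w = {1..int (Suc n)}"
      by auto
    ultimately show "w \<in> signed_words (Suc n)"
      using uv(1,2) by (auto simp: signed_words_def)
  qed
next
  fix n b w assume b: "b \<in> {[int n + 1], [- (int n + 1)]}" and w: "w \<in> signed_words n"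
  have "\<bar>y\<bar> \<le> int n" if "y \<in> set w" for y
    using that w unfolding signed_words_def by fastforce
  then show "set b \<inter> set w = {}"
    using b by force
qed (auto simp: signed_words_def)

text \<open>
  The values on the positive numbers; they determine a signed permutation because it is odd.
\<close>

definition window :: "nat \<Rightarrow> (int \<Rightarrow> int) \<Rightarrow> int list" where
  "window n \<pi> = map (\<lambda>i. \<pi> (int i)) [1..<Suc n]"

lemma length_window [simp]: "length (window n \<pi>) = n"
  by (simp add: window_def)

lemma nth_window: "i < n \<Longrightarrow> window n \<pi> ! i = \<pi> (int i + 1)"
  by (auto simp: window_def add.commute simp del: upt_Suc)

lemma bij_betw_window: "bij_betw (window n) (signed_perms n) (signed_words n)"
proof (rule bij_betwI')
  fix \<pi> \<sigma>
  assume *: "\<pi> \<in> signed_perms n" "\<sigma> \<in> signed_perms n"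
  show "window n \<pi> = window n \<sigma> \<longleftrightarrow> \<pi> = \<sigma>"
  proof
    assume eq: "window n \<pi> = window n \<sigma>"
    have pos: "\<pi> i = \<sigma> i" if "i \<in> {1..int n}" for i
    proof -
      have "nat (i - 1) < n" "int (nat (i - 1)) + 1 = i"
        using that by auto
      then show ?thesis
        using nth_window[of "nat (i - 1)" n] eq by metis
    qed
    have "\<pi> i = \<sigma> i" for i
    proof (cases "i \<in> {- int n..int n} - {0}")
      case True
      then have "i \<in> {1..int n} \<or> - i \<in> {1..int n}"
        by auto
      moreover have "\<pi> (- i) = - \<pi> i" "\<sigma> (- i) = - \<sigma> i"
        using * by (auto simp: signed_perms_def)
      ultimately show ?thesis
        using pos[of i] pos[of "- i"] by auto
    next
      case False
      have "\<pi> permutes ({- int n..int n} - {0})" "\<sigma> permutes ({- int n..int n} - {0})"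
        using * by (simp_all add: signed_perms_def)
      then have "\<pi> i = i" "\<sigma> i = i"
        using False by (auto intro: permutes_not_in)
      then show ?thesis
        by simp
    qed
    then show "\<pi> = \<sigma>"
      by auto
  qed simp
next
  fix \<pi>
  assume *: "\<pi> \<in> signed_perms n"
  then have perm: "\<pi> permutes ({- int n..int n} - {0})" and odd: "\<pi> (- i) = - \<pi> i" for i
    by (auto simp: signed_perms_def)
  have abs_inj: "i = j" if "\<bar>\<pi> i\<bar> = \<bar>\<pi> j\<bar>" "i > 0" "j > 0" for i j
  proof -
    have "\<pi> i = \<pi> j \<or> \<pi> i = \<pi> (- j)"
      using that odd by (auto simp: abs_eq_iff)
    then have "i = j \<or> i = - j"
      by (simp only: inj_eq[OF permutes_inj[OF perm]])
    then show ?thesis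
      using that by auto
  qed
  have "abs ` \<pi> ` int ` {1..n} = {1..int n}"
  proof (intro equalityI subsetI)
    fix y assume "y \<in> abs ` \<pi> ` int ` {1..n}"
    then obtain i where i: "i \<in> {1..n}" and y: "y = \<bar>\<pi> (int i)\<bar>"
      by auto
    then have "\<pi> (int i) \<in> {- int n..int n} - {0}"
      using permutes_in_image[OF perm, of "int i"] by auto
    then show "y \<in> {1..int n}"
      by (auto simp: y)
  next
    fix y assume y: "y \<in> {1..int n}"
    then have "y \<in> \<pi> ` ({- int n..int n} - {0})"
      by (simp add: permutes_image[OF perm])
    then obtain i where i: "y = \<pi> i" "i \<in> {- int n..int n} - {0}"
      by blast
    then have "y = \<bar>\<pi> \<bar>i\<bar>\<bar>" "nat \<bar>i\<bar> \<in> {1..n}"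
      using y odd[of i] by (auto simp: abs_if)
    then show "y \<in> abs ` \<pi> ` int ` {1..n}"
      by (intro image_eqI[where x = "\<pi> \<bar>i\<bar>"] image_eqI[where x = "\<bar>i\<bar>"] image_eqI[where x = "nat \<bar>i\<bar>"]) auto
  qed
  moreover have inj: "inj_on (\<lambda>i. \<bar>\<pi> (int i)\<bar>) {1..n}"
  proof (rule inj_onI)
    fix i j assume "i \<in> {1..n}" "j \<in> {1..n}" "\<bar>\<pi> (int i)\<bar> = \<bar>\<pi> (int j)\<bar>"
    then show "i = j"
      using abs_inj[of "int i" "int j"] by simp
  qed
  moreover have upt: "set [1..<Suc n] = {1..n}" "distinct [1..<Suc n]"
    by auto
  moreover have "map abs (window n \<pi>) = map (\<lambda>i. \<bar>\<pi> (int i)\<bar>) [1..<Suc n]"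
    by (simp add: window_def comp_def del: upt_Suc)
  then have "distinct (map abs (window n \<pi>))"
    by (simp only: distinct_map upt inj simp_thms)
  moreover have "abs ` set (window n \<pi>) = abs ` \<pi> ` int ` {1..n}"
    unfolding window_def set_map upt(1) by (simp add: image_image)
  ultimately show "window n \<pi> \<in> signed_words n"
    unfolding signed_words_def by (simp only: mem_Collect_eq simp_thms)
next
  fix w assume w: "w \<in> signed_words n"
  then have len: "length w = n" and dist: "distinct (map abs w)" and abs_w: "abs ` set w = {1..int n}"
    by (auto simp: signed_words_length signed_words_def)
  let ?S = "{- int n..int n} - {0}"
  \<comment> \<open>The odd extension of the word to a signed permutation.\<close>
  define \<pi> where "\<pi> i = (if i \<in> ?S then sgn i * w ! (nat \<bar>i\<bar> - 1) else i)" for i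
  have idx: "nat \<bar>i\<bar> - 1 < n" if "i \<in> ?S" for i
    using that by auto
  have entry: "\<bar>w ! j\<bar> \<in> {1..int n}" if "j < n" for j
    using that len abs_w by (metis image_eqI nth_mem)
  have abs_\<pi>: "\<bar>\<pi> i\<bar> = \<bar>w ! (nat \<bar>i\<bar> - 1)\<bar>" if "i \<in> ?S" for i
    using that by (simp add: \<pi>_def abs_mult)
  have odd: "\<pi> (- i) = - \<pi> i" for i
    by (auto simp: \<pi>_def sgn_minus)
  have into: "\<pi> i \<in> ?S" if "i \<in> ?S" for i
  proof -
    have "\<bar>\<pi> i\<bar> \<in> {1..int n}"
      unfolding abs_\<pi>[OF that] by (rule entry[OF idx[OF that]])
    then show ?thesis
      by auto
  qed
  have "inj_on \<pi> ?S"
  proof (rule inj_onI)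
    fix i j assume ij: "i \<in> ?S" "j \<in> ?S" "\<pi> i = \<pi> j"
    let ?i = "nat \<bar>i\<bar> - 1" and ?j = "nat \<bar>j\<bar> - 1"
    have "\<bar>w ! ?i\<bar> = \<bar>w ! ?j\<bar>"
      using abs_\<pi>[OF ij(1)] abs_\<pi>[OF ij(2)] ij(3) by metis
    then have "(map abs w) ! ?i = (map abs w) ! ?j"
      using idx[OF ij(1)] idx[OF ij(2)] by (simp only: nth_map len)
    then have "?i = ?j"
      using nth_eq_iff_index_eq[OF dist, of ?i ?j] idx[OF ij(1)] idx[OF ij(2)]
      by (simp only: length_map len)
    moreover have "\<bar>i\<bar> \<ge> 1" "\<bar>j\<bar> \<ge> 1"
      using ij(1,2) by auto
    ultimately have "\<bar>i\<bar> = \<bar>j\<bar>"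
      by linarith
    moreover have "j \<noteq> - i"
    proof
      assume "j = - i"
      then have "\<pi> i = - \<pi> i"
        using ij(3) odd[of i] by (simp only:)
      then show False
        using into[OF ij(1)] by simp
    qed
    ultimately show "i = j"
      by (auto simp: abs_eq_iff)
  qed
  moreover have "\<pi> ` ?S = ?S"
    using into \<open>inj_on \<pi> ?S\<close> by (intro endo_inj_surj) auto
  ultimately have "\<pi> permutes ?S"
    by (intro bij_imp_permutes) (auto simp: bij_betw_def \<pi>_def)
  then have "\<pi> \<in> signed_perms n"
    using odd by (simp add: signed_perms_def)
  moreover have "w = window n \<pi>"
    by (rule nth_equalityI) (auto simp: len nth_window \<pi>_def nat_add_distrib)
  ultimately show "\<exists>\<pi>\<in>signed_perms n. w = window n \<pi>"
    by blast
qed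

lemma signed_perms_0: "\<pi> \<in> signed_perms n \<Longrightarrow> \<pi> 0 = 0"
  by (auto simp: signed_perms_def permutes_not_in)

lemma des_B_eq_descents:
  assumes "\<pi> \<in> signed_perms n"
  shows "des_B n \<pi> = descents 0 (window n \<pi>)"
proof -
  have w0: "(0 # window n \<pi>) ! i = \<pi> (int i)" if "i < n" for i
    using that signed_perms_0[OF assms] by (cases i) (auto simp: nth_window add.commute)
  have "{i \<in> {0..int n - 1}. \<pi> i > \<pi> (i + 1)} = int ` {i \<in> {..<n}. \<pi> (int i) > \<pi> (int i + 1)}"
  proof (intro equalityI subsetI)
    fix i assume "i \<in> {i \<in> {0..int n - 1}. \<pi> i > \<pi> (i + 1)}"
    then show "i \<in> int ` {i \<in> {..<n}. \<pi> (int i) > \<pi> (int i + 1)}"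
      by (intro image_eqI[where x = "nat i"]) auto
  qed auto
  also have "{i \<in> {..<n}. \<pi> (int i) > \<pi> (int i + 1)} =
      {i \<in> {..<length (window n \<pi>)}. (0 # window n \<pi>) ! i > window n \<pi> ! i}"
    by (rule Collect_cong) (auto simp: w0 nth_window)
  finally show ?thesis
    by (simp add: des_B_def descents_eq_card card_image)
qed

text \<open>
  The only difference is the position \<open>0\<close>, which is a descent if and only if \<open>\<pi> 1\<close> is negative.
\<close>

lemma des_B_eq_des_A:
  assumes "\<pi> \<in> signed_perms n" "n \<ge> 1"
  shows "des_B n \<pi> = (if \<pi> 1 < 0 then 1 else 0) + des_A n \<pi>"
proof -
  define D where "D = {i \<in> {1..int n - 1}. \<pi> i > \<pi> (i + 1)}"
  have "finite D"
    by (rule finite_subset[of _ "{1..int n - 1}"]) (auto simp: D_def)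
  moreover have "0 \<notin> D"
    by (simp add: D_def)
  moreover have "{0..int n - 1} = insert 0 {1..int n - 1}"
    using assms(2) by auto
  then have "{i \<in> {0..int n - 1}. \<pi> i > \<pi> (i + 1)} = (if \<pi> 1 < 0 then insert 0 D else D)"
    using signed_perms_0[OF assms(1)] by (auto simp: D_def)
  then have "des_B n \<pi> = card (if \<pi> 1 < 0 then insert 0 D else D)"
    by (simp only: des_B_def)
  moreover have "des_A n \<pi> = card D"
    by (simp only: des_A_def D_def)
  ultimately show ?thesis
    by simp
qed

lemma fdes_eq_flag_descents:
  assumes "\<pi> \<in> signed_perms n" "n \<ge> 1"
  shows "fdes n \<pi> = flag_descents (window n \<pi>)"
proof -
  obtain x v where w: "window n \<pi> = x # v"
    using assms(2) by (metis length_window list.exhaust list.size(3) not_one_le_zero)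
  then have "x = \<pi> 1"
    using nth_window[of 0 n \<pi>] assms(2) by simp
  then show ?thesis
    using des_B_eq_descents[OF assms(1)] des_B_eq_des_A[OF assms] by (simp add: w fdes_def)
qed

lemma pcompose_monom: "pcompose (monom 1 k) ([:0, 1:]\<^sup>2) = X ^ (2 * k)"
proof -
  have "pcompose (X ^ k) (X\<^sup>2) = (X\<^sup>2) ^ k"
    by (induction k) (simp_all add: pcompose_1 pcompose_mult, simp add: X_def pcompose_pCons)
  then show ?thesis
    by (simp only: power_mult) (simp only: X_power[symmetric] X_def[symmetric])
qed

lemma B_poly_eq_sum_words:
  "pcompose (B_poly n) ([:0, 1:]\<^sup>2) = (\<Sum>w\<in>signed_words n. X ^ (2 * descents 0 w))"
proof (cases "n = 0")
  case True
  then show ?thesis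
    using insertion_family_signed_words by (simp add: B_poly_def pcompose_1 insertion_family_def)
next
  case False
  then have "pcompose (B_poly n) ([:0, 1:]\<^sup>2) = (\<Sum>\<pi>\<in>signed_perms n. X ^ (2 * descents 0 (window n \<pi>)))"
    by (simp add: B_poly_def pcompose_sum pcompose_monom des_B_eq_descents)
  then show ?thesis
    using sum.reindex_bij_betw[OF bij_betw_window] by simp
qed

lemma S_poly_eq_sum_words: "S_poly n = (\<Sum>w\<in>signed_words n. X ^ flag_descents w)"
proof (cases "n = 0")
  case True
  then show ?thesis
    using insertion_family_signed_words by (simp add: S_poly_def insertion_family_def)
next
  case False
  then have "S_poly n = (\<Sum>\<pi>\<in>signed_perms n. X ^ flag_descents (window n \<pi>))"
    by (simp add: S_poly_def fdes_eq_flag_descents X_power)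
  then show ?thesis
    using sum.reindex_bij_betw[OF bij_betw_window] by simp
qed

lemma signed_words_bound:
  assumes "w \<in> signed_words n"
  shows "\<forall>y\<in>set w. - (int n + 1) < y \<and> y < int n + 1"
proof
  fix y assume "y \<in> set w"
  then have "\<bar>y\<bar> \<in> {1..int n}"
    using assms unfolding signed_words_def by blast
  then show "- (int n + 1) < y \<and> y < int n + 1"
    by auto
qed

lemma sum_signed_blocks:
  "(\<Sum>b\<in>{[int n + 1], [- (int n + 1)]}. \<Sum>i\<le>k. F i b) = (\<Sum>i\<le>k. F i [int n + 1] + F i [- (int n + 1)])"
  by (simp add: sum.distrib)

lemma theta_numerators_B_poly:
  "theta_numerators (1 + X\<^sup>2) (\<lambda>n. pcompose (B_poly n) ([:0, 1:]\<^sup>2))"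
  unfolding B_poly_eq_sum_words
proof (rule theta_numerators_insertion[OF insertion_family_signed_words])
  fix n w assume w: "w \<in> signed_words n"
  let ?d = "descents 0 w"
  have "(\<Sum>b\<in>{[int n + 1], [- (int n + 1)]}. \<Sum>i\<le>length w. X ^ (2 * descents 0 (insert_at i b w))) =
      of_nat (2 * ?d + 1) * (X\<^sup>2) ^ ?d + (of_nat (2 * length w + 1) - of_nat (2 * ?d)) * (X\<^sup>2) ^ (?d + 1)"
    unfolding sum_signed_blocks power_mult using signed_words_bound[OF w]
    by (intro sum_descents_insert_extremes) auto
  then show "(\<Sum>b\<in>{[int n + 1], [- (int n + 1)]}. \<Sum>i\<le>length w. X ^ (2 * descents 0 (insert_at i b w))) =
      (1 + X\<^sup>2 + of_nat (2 * n) * X\<^sup>2) * X ^ (2 * ?d) + of_nat (2 * ?d) * (X ^ (2 * ?d) - X ^ (2 * ?d + 2))"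
    unfolding signed_words_length[OF w]
    by (simp only:) (simp add: algebra_simps power_mult power_add power2_eq_square)
qed simp

lemma theta_numerators_S_poly: "theta_numerators (1 + X) S_poly"
  unfolding S_poly_eq_sum_words[abs_def]
proof (rule theta_numerators_insertion[OF insertion_family_signed_words])
  fix n w assume w: "w \<in> signed_words n"
  let ?f = "flag_descents w"
  have "(\<Sum>b\<in>{[int n + 1], [- (int n + 1)]}. \<Sum>i\<le>length w. X ^ flag_descents (insert_at i b w)) =
      of_nat (?f + 1) * X ^ ?f + X ^ (?f + 1) + (of_nat (2 * length w) - of_nat ?f) * X ^ (?f + 2)"
    unfolding sum_signed_blocks using signed_words_bound[OF w]
    by (intro sum_flag_descents_insert_extremes) auto
  then show "(\<Sum>b\<in>{[int n + 1], [- (int n + 1)]}. \<Sum>i\<le>length w. X ^ flag_descents (insert_at i b w)) =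
      (1 + X + of_nat (2 * n) * X\<^sup>2) * X ^ ?f + of_nat ?f * (X ^ ?f - X ^ (?f + 2))"
    unfolding signed_words_length[OF w]
    by (simp only:) (simp add: algebra_simps power_add power2_eq_square)
qed simp

section \<open>Left peaks of Stirling permutations\<close>


text \<open>
  The first argument is again the letter in front of the word.
\<close>

fun left_peaks :: "'a::linorder \<Rightarrow> 'a list \<Rightarrow> nat" where
  "left_peaks a [] = 0"
| "left_peaks a [x] = 0"
| "left_peaks a (x # y # w) = (if a < x \<and> y < x then 1 else 0) + left_peaks x (y # w)"

lemma left_peaks_eq_card:
  "left_peaks a w = card {i \<in> {..<length w - 1}. (a # w) ! i < w ! i \<and> w ! (i + 1) < w ! i}"
proof -
  have "left_peaks a w = (\<Sum>i<length w - 1. of_bool ((a # w) ! i < w ! i \<and> w ! (i + 1) < w ! i))"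
    by (induction a w rule: left_peaks.induct) (simp_all add: sum.lessThan_Suc_shift del: sum.lessThan_Suc)
  then show ?thesis
    by (simp add: Int_def)
qed

text \<open>
  The letter in front matters only for a peak at the first letter, and two letters that are not
  smaller than the first letter both exclude it.
\<close>

lemma left_peaks_head_le: "w = y # v \<Longrightarrow> y \<le> b \<Longrightarrow> y \<le> c \<Longrightarrow> left_peaks b w = left_peaks c w"
  by (cases v) auto

text \<open>
  The larger of the two new letters is always a left peak and the smaller one never is.  In a gap
  next to a left peak the insertion destroys that peak, in every other gap it destroys none.  No two left
  peaks are adjacent, so \<open>p\<close> left peaks touch exactly \<open>2 p\<close> gaps.  In the induction only the
  first two gaps need care, because the letter in front of the remaining word changes there.
\<close>

lemma sum_left_peaks_insert_max_pair:
  fixes x :: "'b::comm_ring_1"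
  assumes "a < m" "m < m'" "\<forall>y\<in>set w. y < m"
  shows "(\<Sum>i\<le>length w. x ^ left_peaks a (insert_at i [m', m] w)) =
    of_nat (2 * left_peaks a w) * x ^ left_peaks a w +
    (of_nat (length w + 1) - of_nat (2 * left_peaks a w)) * x ^ (left_peaks a w + 1)"
  using assms
proof (induction a w rule: left_peaks.induct)
  case (1 a)
  then show ?case by auto
next
  case (2 a y)
  then have "a < m'" "y < m'" "y < m" "\<not> m < y" "\<not> m' < y" "\<not> m' < m"
    by auto
  then show ?case
    using 2 by (simp add: sum.atMost_Suc)
next
  case (3 a y z w)
  let ?k = "if a < y \<and> z < y then 1 else 0 :: nat"
  let ?p = "left_peaks y (z # w)"
  let ?rest = "\<Sum>i\<le>length w. x ^ left_peaks y (z # insert_at i [m', m] w)"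
  have less: "a < m'" "y < m'" "y < m" "\<not> m < y" "\<not> m' < y" "z < m" "\<not> m' < m" "m < m'"
    using 3 by auto
  have all: "(\<Sum>i\<le>length (y # z # w). x ^ left_peaks a (insert_at i [m', m] (y # z # w))) =
      x ^ (1 + ?p) + (x ^ (1 + left_peaks m (z # w)) + x ^ ?k * ?rest)"
    using less unfolding sum_insert_at_Cons[where F = "\<lambda>v. x ^ left_peaks a v"]
      sum_insert_at_Cons[where F = "\<lambda>v. x ^ left_peaks a (y # v)"]
    by (simp add: power_add sum_distrib_left)
  have "(\<Sum>i\<le>length (z # w). x ^ left_peaks y (insert_at i [m', m] (z # w))) =
      x ^ (1 + left_peaks m (z # w)) + ?rest"
    using less unfolding sum_insert_at_Cons[where F = "\<lambda>v. x ^ left_peaks y v"]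
    by simp
  then have rest: "?rest = of_nat (2 * ?p) * x ^ ?p +
      (of_nat (length (z # w) + 1) - of_nat (2 * ?p)) * x ^ (?p + 1) - x ^ (1 + left_peaks m (z # w))"
    using 3 less by (simp add: algebra_simps)
  show ?case
  proof (cases "a < y \<and> z < y")
    case True
    then have "left_peaks m (z # w) = ?p"
      using less by (intro left_peaks_head_le) auto
    then show ?thesis
      unfolding all rest using True by (simp add: algebra_simps)
  next
    case False
    then show ?thesis
      unfolding all rest by (auto simp: algebra_simps)
  qed
qed

text \<open>
  The word of the permutation \<open>Phi w\<close>, computed from left to right; the set collects the letters
  that have occurred already.
\<close>

fun Phi_word :: "nat set \<Rightarrow> nat list \<Rightarrow> nat list" where
  "Phi_word S [] = []"
| "Phi_word S (x # w) = (if x \<in> S then 2 * x - 1 else 2 * x) # Phi_word (insert x S) w"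

lemma length_Phi_word [simp]: "length (Phi_word S w) = length w"
  by (induction w arbitrary: S) auto

lemma nth_Phi_word:
  "i < length w \<Longrightarrow> Phi_word S w ! i = (if w ! i \<in> S \<union> set (take i w) then 2 * w ! i - 1 else 2 * w ! i)"
  by (induction w arbitrary: S i) (auto simp: nth_Cons split: nat.splits)

lemma Phi_word_append: "Phi_word S (u @ v) = Phi_word S u @ Phi_word (S \<union> set u) v"
  by (induction u arbitrary: S) auto

lemma Phi_word_insert_notin: "k \<notin> set w \<Longrightarrow> Phi_word (insert k S) w = Phi_word S w"
  by (induction w arbitrary: S) (auto simp: insert_commute[of _ k])

text \<open>
  Inserting two adjacent copies of a new letter into a Stirling permutation amounts to inserting a
  descending pair of consecutive numbers into the word of its image.
\<close>

lemma Phi_word_insert_at: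
  assumes "k \<notin> set w" "i \<le> length w"
  shows "Phi_word {} (insert_at i [k, k] w) = insert_at i [2 * k, 2 * k - 1] (Phi_word {} w)"
proof -
  have "k \<notin> set (take i w)" "k \<notin> set (drop i w)"
    using assms(1) by (auto dest: in_set_takeD in_set_dropD)
  moreover have "Phi_word {} w = Phi_word {} (take i w) @ Phi_word (set (take i w)) (drop i w)"
    using Phi_word_append[of "{}" "take i w" "drop i w"] by simp
  ultimately show ?thesis
    using assms(2) by (simp add: insert_at_def Phi_word_append Phi_word_insert_notin)
qed

lemma subseq_triple_iff:
  "subseq [x, y, z] w \<longleftrightarrow> (\<exists>p q s. p < q \<and> q < s \<and> s < length w \<and> w ! p = x \<and> w ! q = y \<and> w ! s = z)"
proof
  assume "subseq [x, y, z] w"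
  then obtain a b c d where w: "w = a @ x # b @ y # c @ z # d"
    by (auto dest!: list_emb_ConsD)
  then show "\<exists>p q s. p < q \<and> q < s \<and> s < length w \<and> w ! p = x \<and> w ! q = y \<and> w ! s = z"
    by (intro exI[of _ "length a"] exI[of _ "length a + 1 + length b"]
        exI[of _ "length a + 1 + length b + 1 + length c"]) (simp add: nth_append)
next
  assume "\<exists>p q s. p < q \<and> q < s \<and> s < length w \<and> w ! p = x \<and> w ! q = y \<and> w ! s = z"
  then obtain p q s where pqs: "p < q" "q < s" "s < length w" and xyz: "w ! p = x" "w ! q = y" "w ! s = z"
    by blast
  have drop_le: "subseq u v" if "subseq u (drop k v)" for u v :: "'a list" and k
    using list_emb_append2[OF that, of "take k v"] by simp
  have "drop (Suc q) w ! (s - Suc q) \<in> set (drop (Suc q) w)"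
    using pqs by (intro nth_mem) simp
  then have "subseq [w ! s] (drop (Suc q) w)"
    using pqs by (simp add: subseq_singleton_left)
  then have "subseq [w ! q, w ! s] (drop q w)"
    using pqs Cons_nth_drop_Suc[of q w] by (metis less_trans subseq_Cons2)
  moreover have "drop q w = drop (q - Suc p) (drop (Suc p) w)"
    using pqs by simp
  ultimately have "subseq [w ! q, w ! s] (drop (Suc p) w)"
    using drop_le by simp
  then have "subseq [w ! p, w ! q, w ! s] (drop p w)"
    using pqs Cons_nth_drop_Suc[of p w] by (metis less_trans subseq_Cons2)
  then show "subseq [x, y, z] w"
    unfolding xyz by (rule drop_le)
qed

text \<open>
  The condition on the entries between two equal ones expressed by a forbidden subsequence: this form
  passes to subwords, which index conditions do only after renumbering.
\<close>

lemma stirling_perms_iff: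
  "w \<in> stirling_perms n \<longleftrightarrow> mset w = mset_set {1..n} + mset_set {1..n} \<and>
     (\<forall>x y. subseq [x, y, x] w \<longrightarrow> x < y)"
proof -
  have "(\<forall>p q s. p < q \<and> q < s \<and> s < length w \<and> w ! p = w ! s \<longrightarrow> w ! q > w ! p) \<longleftrightarrow>
      (\<forall>x y. subseq [x, y, x] w \<longrightarrow> x < y)"
    unfolding subseq_triple_iff by metis
  then show ?thesis
    by (simp only: stirling_perms_def permutations_of_multiset_def mem_Collect_eq)
qed

lemma stirling_perms_set: "w \<in> stirling_perms n \<Longrightarrow> set w = {1..n}"
  by (simp add: stirling_perms_iff flip: set_mset_mset)

lemma stirling_perms_length: "w \<in> stirling_perms n \<Longrightarrow> length w = 2 * n"
  by (simp add: stirling_perms_iff flip: size_mset)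

lemma subseq_Cons_append_notin: "k \<notin> set u \<Longrightarrow> subseq (k # zs) (u @ ys) \<Longrightarrow> subseq (k # zs) ys"
  by (induction u) (auto simp: subseq_Cons2_neq)

text \<open>
  The two copies of the largest letter must be adjacent, as the entries between them would have to be
  larger.  Conversely, the new letters never violate the condition for an older letter.
\<close>

lemma insertion_family_stirling_perms: "insertion_family stirling_perms (\<lambda>n. {[Suc n, Suc n]})"
proof (rule insertion_familyI)
  fix n w
  have mset_Suc: "mset_set {1..Suc n} = add_mset (Suc n) (mset_set {1..n})"
    by (simp add: atLeastAtMostSuc_conv)
  have "w \<in> stirling_perms (Suc n) \<longleftrightarrow>
      (\<exists>u v. w = u @ [Suc n, Suc n] @ v \<and> u @ v \<in> stirling_perms n)"
  proof
    let ?k = "Suc n"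
    assume w: "w \<in> stirling_perms ?k"
    then have mset_w: "mset w = mset_set {1..?k} + mset_set {1..?k}"
      and between: "subseq [x, y, x] w \<Longrightarrow> x < y" for x y
      by (auto simp: stirling_perms_iff)
    have "?k \<in> set w"
      using stirling_perms_set[OF w] by simp
    then obtain u w' where u: "w = u @ ?k # w'" "?k \<notin> set u"
      by (metis split_list_first)
    have "count (mset w) ?k = 2"
      unfolding mset_w by simp
    then have "count (mset w') ?k = 1"
      using u by (simp add: count_mset_0_iff[THEN iffD2])
    then have "?k \<in> set w'"
      by (metis count_mset_0_iff zero_neq_one)
    then obtain b v where b: "w' = b @ ?k # v"
      by (metis split_list_first)
    \<comment> \<open>A letter between the two copies of the largest one would have to be larger still.\<close>
    have "b = []"
    proof (cases b)
      case (Cons y b')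
      have "subseq [?k, y, ?k] ([?k, y] @ b' @ [?k])"
        by (simp add: subseq_singleton_left)
      then have "subseq [?k, y, ?k] (u @ ([?k, y] @ b' @ [?k]) @ v)"
        by (rule list_emb_append2[OF list_emb_prefix]) 
      then have "?k < y"
        by (intro between) (simp add: u b Cons)
      moreover have "y \<in> {1..?k}"
        using stirling_perms_set[OF w] by (auto simp: u b Cons)
      ultimately show ?thesis
        by simp
    qed
    then have w_eq: "w = u @ [?k, ?k] @ v"
      by (simp add: u b)
    have "mset (u @ v) = mset_set {1..n} + mset_set {1..n}"
      using mset_w unfolding mset_Suc w_eq by simp
    moreover have "subseq [x, y, x] w" if "subseq [x, y, x] (u @ v)" for x y
    proof -
      have "subseq (u @ v) w"
        unfolding w_eq by (intro list_emb_append_mono list_emb_append2) auto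
      then show ?thesis
        using that subseq_order.trans by blast
    qed
    ultimately have "u @ v \<in> stirling_perms n"
      using between unfolding stirling_perms_iff by blast
    then show "\<exists>u v. w = u @ [?k, ?k] @ v \<and> u @ v \<in> stirling_perms n"
      using w_eq by blast
  next
    let ?k = "Suc n"
    assume "\<exists>u v. w = u @ [?k, ?k] @ v \<and> u @ v \<in> stirling_perms n"
    then obtain u v where w: "w = u @ [?k, ?k] @ v" and uv: "u @ v \<in> stirling_perms n"
      by blast
    have set_uv: "set u \<union> set v = {1..n}"
      using stirling_perms_set[OF uv] by simp
    have bound: "x \<le> n" if "x \<in> set u \<union> set v" for x
      using that unfolding set_uv by simp
    then have k: "?k \<notin> set u" "?k \<notin> set v"
      by force+
    have "mset w = mset (u @ v) + {#?k, ?k#}"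
      by (simp add: w)
    also have "\<dots> = mset_set {1..?k} + mset_set {1..?k}"
      using uv unfolding mset_Suc stirling_perms_iff by simp
    finally have "mset w = mset_set {1..?k} + mset_set {1..?k}" .
    moreover have "x < y" if sub: "subseq [x, y, x] w" for x y
    proof (cases "x = ?k")
      case True
      then have "subseq [?k, y, ?k] (?k # ?k # v)"
        using subseq_Cons_append_notin[OF k(1), of "[y, ?k]" "?k # ?k # v"] sub by (simp only: w append.simps)
      then have "subseq [y, ?k] (?k # v)"
        by simp
      then have "?k \<in> set v"
        by (cases "y = ?k") (auto simp: subseq_singleton_left subseq_Cons2_neq dest: list_emb_set)
      then show ?thesis
        using k by simp
    next
      case False
      have "x \<in> set w"
        using sub by (auto dest: list_emb_set)
      then have "x \<le> n"
        using False bound by (auto simp: w)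
      show ?thesis
      proof (cases "y = ?k")
        case True
        then show ?thesis
          using \<open>x \<le> n\<close> by simp
      next
        case y: False
        have "filter (\<lambda>z. z \<noteq> ?k) u = u" "filter (\<lambda>z. z \<noteq> ?k) v = v"
          using k by (auto simp: filter_id_conv)
        then have "subseq [x, y, x] (u @ v)"
          using subseq_filter[OF sub, of "\<lambda>z. z \<noteq> ?k"] False y by (simp add: w)
        then show ?thesis
          using uv by (simp add: stirling_perms_iff)
      qed
    qed
    ultimately show "w \<in> stirling_perms ?k"
      by (simp add: stirling_perms_iff)
  qed
  then show "w \<in> stirling_perms (Suc n) \<longleftrightarrow>
      (\<exists>u v b. w = u @ b @ v \<and> u @ v \<in> stirling_perms n \<and> b \<in> {[Suc n, Suc n]})"
    by blast
next
  fix n b w assume "b \<in> {[Suc n, Suc n]}" "w \<in> stirling_perms n"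
  then show "set b \<inter> set w = {}"
    using stirling_perms_set[of w n] by auto
qed (auto simp: stirling_perms_iff)

lemma Phi_eq_nth_Phi_word: "i < length w \<Longrightarrow> Phi w (Suc i) = Phi_word {} w ! i"
  by (simp add: Phi_def nth_Phi_word)

lemma inj_on_Phi: "inj_on Phi (stirling_perms n)"
proof (rule inj_onI)
  fix v w assume "v \<in> stirling_perms n" "w \<in> stirling_perms n" and eq: "Phi v = Phi w"
  then have len: "length v = length w"
    by (simp add: stirling_perms_length)
  \<comment> \<open>Halving and rounding up undoes both \<open>x \<mapsto> 2 x\<close> and \<open>x \<mapsto> 2 x - 1\<close>.\<close>
  have decode: "u ! i = (Phi u (Suc i) + 1) div 2" if "i < length u" for u i
    using that by (cases "u ! i") (auto simp: Phi_def)
  show "v = w"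
    using len eq by (intro nth_equalityI) (simp_all add: decode)
qed

lemma lpk_Phi: "lpk (length w) (Phi w) = left_peaks 0 (Phi_word {} w)"
proof -
  let ?w = "Phi_word {} w"
  have w0: "(0 # ?w) ! i = Phi w i" if "i < length w" for i
    using that by (cases i) (auto simp: Phi_eq_nth_Phi_word, simp add: Phi_def)
  have "{i \<in> {1..length w - 1}. Phi w (i - 1) < Phi w i \<and> Phi w i > Phi w (i + 1)} =
      Suc ` {i \<in> {..<length w - 1}. Phi w i < Phi w (Suc i) \<and> Phi w (Suc i) > Phi w (Suc i + 1)}"
  proof (intro equalityI subsetI)
    fix i assume i: "i \<in> {i \<in> {1..length w - 1}. Phi w (i - 1) < Phi w i \<and> Phi w i > Phi w (i + 1)}"
    then obtain j where "i = Suc j"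
      by (cases i) auto
    then show "i \<in> Suc ` {i \<in> {..<length w - 1}. Phi w i < Phi w (Suc i) \<and> Phi w (Suc i) > Phi w (Suc i + 1)}"
      using i by (intro image_eqI[where x = j]) auto
  qed auto
  also have "{i \<in> {..<length w - 1}. Phi w i < Phi w (Suc i) \<and> Phi w (Suc i) > Phi w (Suc i + 1)} =
      {i \<in> {..<length ?w - 1}. (0 # ?w) ! i < ?w ! i \<and> ?w ! (i + 1) < ?w ! i}"
    by (rule Collect_cong) (auto simp: w0 Phi_eq_nth_Phi_word)
  finally show ?thesis
    by (simp add: lpk_def left_peaks_eq_card card_image)
qed

lemma N_poly_eq_sum_words:
  "pcompose (N_poly n) ([:0, 1:]\<^sup>2) = (\<Sum>w\<in>stirling_perms n. X ^ (2 * left_peaks 0 (Phi_word {} w)))"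
proof (cases "n = 0")
  case True
  then show ?thesis
    using insertion_family_stirling_perms by (simp add: N_poly_def pcompose_1 insertion_family_def)
next
  case False
  then have "pcompose (N_poly n) ([:0, 1:]\<^sup>2) = (\<Sum>w\<in>stirling_perms n. X ^ (2 * lpk (2 * n) (Phi w)))"
    by (simp add: N_poly_def pcompose_sum pcompose_monom sum.reindex[OF inj_on_Phi])
  also have "\<dots> = (\<Sum>w\<in>stirling_perms n. X ^ (2 * left_peaks 0 (Phi_word {} w)))"
    by (intro sum.cong refl) (simp flip: lpk_Phi add: stirling_perms_length)
  finally show ?thesis .
qed

lemma theta_numerators_N_poly:
  "theta_numerators (X\<^sup>2) (\<lambda>n. pcompose (N_poly n) ([:0, 1:]\<^sup>2))"
  unfolding N_poly_eq_sum_words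
proof (rule theta_numerators_insertion[OF insertion_family_stirling_perms])
  fix n w assume w: "w \<in> stirling_perms n"
  let ?w = "Phi_word {} w"
  let ?p = "left_peaks 0 ?w"
  have notin: "Suc n \<notin> set w" and bound: "\<forall>y\<in>set ?w. y < 2 * Suc n - 1"
  proof -
    show "Suc n \<notin> set w"
      using stirling_perms_set[OF w] by simp
    show "\<forall>y\<in>set ?w. y < 2 * Suc n - 1"
    proof
      fix y assume "y \<in> set ?w"
      then obtain i where i: "i < length w" "y = ?w ! i"
        by (auto simp: in_set_conv_nth)
      then have "w ! i \<in> {1..n}"
        using stirling_perms_set[OF w] nth_mem by blast
      then show "y < 2 * Suc n - 1"
        using i by (auto simp: nth_Phi_word)
    qed
  qed
  have "(\<Sum>b\<in>{[Suc n, Suc n]}. \<Sum>i\<le>length w. X ^ (2 * left_peaks 0 (Phi_word {} (insert_at i b w)))) =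
      (\<Sum>i\<le>length ?w. (X\<^sup>2) ^ left_peaks 0 (insert_at i [2 * Suc n, 2 * Suc n - 1] ?w))"
    using notin by (simp add: Phi_word_insert_at power_mult del: sum.atMost_Suc mult_Suc_right)
  also have "\<dots> = of_nat (2 * ?p) * (X\<^sup>2) ^ ?p +
      (of_nat (length ?w + 1) - of_nat (2 * ?p)) * (X\<^sup>2) ^ (?p + 1)"
    using bound by (intro sum_left_peaks_insert_max_pair) auto
  also have "\<dots> = (X\<^sup>2 + of_nat (2 * n) * X\<^sup>2) * X ^ (2 * ?p) + of_nat (2 * ?p) * (X ^ (2 * ?p) - X ^ (2 * ?p + 2))"
    unfolding length_Phi_word stirling_perms_length[OF w] by (simp add: algebra_simps power_mult power_add power2_eq_square)
  finally show "(\<Sum>b\<in>{[Suc n, Suc n]}. \<Sum>i\<le>length w. X ^ (2 * left_peaks 0 (Phi_word {} (insert_at i b w)))) =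
      (X\<^sup>2 + of_nat (2 * n) * X\<^sup>2) * X ^ (2 * ?p) + of_nat (2 * ?p) * (X ^ (2 * ?p) - X ^ (2 * ?p + 2))" .
qed simp

section \<open>The numerators of the iterated derivatives of \<open>r_fun\<close>\<close>

text \<open>
  The sequence that the recurrence for \<open>a = x\<close> defines; it is identified with \<open>T_poly\<close> below.
\<close>

primrec T_num :: "nat \<Rightarrow> int poly" where
  "T_num 0 = 1"
| "T_num (Suc n) = (X + of_nat (2 * n) * X\<^sup>2) * T_num n + euler_poly_op (T_num n)"

declare T_num.simps(2) [simp del]

lemma coeff_X_mult: "coeff (X * p) k = (if k = 0 then 0 else coeff p (k - 1))"
  by (simp add: X_def coeff_pCons split: nat.split)

lemma coeff_T_num_Suc:
  "coeff (T_num (Suc n)) k = int k * coeff (T_num n) k +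
     (if k \<ge> 1 then coeff (T_num n) (k - 1) else 0) +
     (if k \<ge> 2 then (int (2 * n) - int (k - 2)) * coeff (T_num n) (k - 2) else 0)"
proof -
  have eq: "T_num (Suc n) = X * T_num n + of_nat (2 * n) * (X * (X * T_num n)) +
      X * pderiv (T_num n) - X * (X * (X * pderiv (T_num n)))"
    by (simp add: T_num.simps euler_poly_op_def power2_eq_square algebra_simps)
  have "k = 0 \<or> k = 1 \<or> k = 2 \<or> (\<exists>j. k = j + 3)"
    by presburger
  then show ?thesis
    unfolding eq
    by (auto simp: coeff_X_mult coeff_pderiv of_nat_poly algebra_simps numeral_2_eq_2 numeral_3_eq_3)
qed

lemma coeff_T_num_outside: "k \<notin> {1..2 * Suc n - 1} \<Longrightarrow> coeff (T_num (Suc n)) k = 0"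
proof (induction n arbitrary: k)
  case 0
  then show ?case
    by (auto simp: T_num.simps X_def coeff_pCons split: nat.splits)
next
  case (Suc n)
  have "coeff (T_num (Suc n)) k = 0" "coeff (T_num (Suc n)) (k - 1) = 0" "coeff (T_num (Suc n)) (k - 2) = 0"
    using Suc.prems by (intro Suc.IH; force)+
  then show ?case
    unfolding coeff_T_num_Suc[of "Suc n"] by (simp only: mult_zero_right if_cancel add_0)
qed

text \<open>
  All three terms of the coefficient recurrence are nonnegative, and at each index in the range at
  least one is positive: the first one up to the old degree \<open>2 n + 1\<close>, and the second and the third
  one at the two new indices.
\<close>

lemma coeff_T_num_pos: "k \<in> {1..2 * Suc n - 1} \<Longrightarrow> coeff (T_num (Suc n)) k > 0"
proof (induction n arbitrary: k)
  case 0
  then show ?case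
    by (auto simp: T_num.simps X_def coeff_pCons split: nat.splits)
next
  case (Suc n)
  let ?c = "coeff (T_num (Suc n))"
  have nonneg: "?c j \<ge> 0" for j
    using Suc.IH[of j] coeff_T_num_outside[of j n] by (cases "j \<in> {1..2 * Suc n - 1}") auto
  define t0 t1 t2 where
    "t0 = int k * ?c k" and "t1 = (if k \<ge> 1 then ?c (k - 1) else 0)" and
    "t2 = (if k \<ge> 2 then (int (2 * Suc n) - int (k - 2)) * ?c (k - 2) else 0)"
  have "t0 \<ge> 0" "t1 \<ge> 0" "t2 \<ge> 0"
    using Suc.prems nonneg by (auto simp: t0_def t1_def t2_def)
  moreover consider "k \<le> 2 * Suc n - 1" | "k = 2 * Suc n" | "k = 2 * Suc n + 1"
    using Suc.prems by force
  then have "t0 > 0 \<or> t1 > 0 \<or> t2 > 0"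
  proof cases
    case 1
    then have "t0 > 0"
      using Suc.prems Suc.IH[of k] by (simp add: t0_def)
    then show ?thesis ..
  next
    case 2
    then have "t1 > 0"
      using Suc.IH[of "k - 1"] by (simp add: t1_def)
    then show ?thesis by simp
  next
    case 3
    then have "t2 > 0"
      using Suc.IH[of "k - 2"] by (simp add: t2_def)
    then show ?thesis by simp
  qed
  moreover have "coeff (T_num (Suc (Suc n))) k = t0 + t1 + t2"
    unfolding t0_def t1_def t2_def by (rule coeff_T_num_Suc)
  ultimately show ?case
    by linarith
qed

abbreviation real_poly :: "int poly \<Rightarrow> real poly" where
  "real_poly \<equiv> map_poly real_of_int"

lemma real_poly_add: "real_poly (p + q) = real_poly p + real_poly q"
  by (rule poly_eqI) (simp add: coeff_map_poly)

lemma real_poly_diff: "real_poly (p - q) = real_poly p - real_poly q"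
  by (rule poly_eqI) (simp add: coeff_map_poly)

lemma real_poly_mult: "real_poly (p * q) = real_poly p * real_poly q"
  by (rule poly_eqI) (simp add: coeff_map_poly coeff_mult)

lemma real_poly_pderiv: "real_poly (pderiv p) = pderiv (real_poly p)"
  by (rule poly_eqI) (simp add: coeff_map_poly coeff_pderiv)

lemma real_poly_of_nat: "real_poly (of_nat n) = of_nat n"
  by (induction n) (simp_all add: real_poly_add)

lemma real_poly_X: "real_poly X = [:0, 1:]"
  by (simp add: X_def map_poly_pCons)

definition T_val :: "nat \<Rightarrow> real \<Rightarrow> real" where
  "T_val n x = poly (real_poly (T_num n)) x"

lemma T_val_0 [simp]: "T_val 0 x = 1"
  by (simp add: T_val_def)

lemma T_val_Suc:
  "T_val (Suc n) x = (x + real (2 * n) * x\<^sup>2) * T_val n x +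
     x * (1 - x\<^sup>2) * poly (pderiv (real_poly (T_num n))) x"
  unfolding T_val_def T_num.simps euler_poly_op_def power2_eq_square
  by (simp add: real_poly_add real_poly_diff real_poly_mult real_poly_pderiv real_poly_X real_poly_of_nat
      del: of_nat_mult) (simp add: algebra_simps del: of_nat_mult)

lemma T_val_has_derivative:
  "(T_val n has_real_derivative poly (pderiv (real_poly (T_num n))) x) (at x)"
  unfolding T_val_def by (rule poly_DERIV)

text \<open>
  That is, \<open>\<theta> r = x r / (1 - x\<^sup>2)\<close>, which is why \<open>a = x\<close> belongs to \<open>r\<close>.
\<close>

lemma r_fun_has_derivative:
  assumes "x \<in> {-1<..<1}"
  shows "(r_fun has_real_derivative r_fun x / (1 - x\<^sup>2)) (at x)"
proof -
  define s t where "s = sqrt (1 + x)" and "t = sqrt (1 - x)"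
  have pos: "s > 0" "t > 0" and sq: "s\<^sup>2 = 1 + x" "t\<^sup>2 = 1 - x"
    using assms by (auto simp: s_def t_def)
  have "(r_fun has_real_derivative (1 / (2 * s) * t - s * - (1 / (2 * t))) / (t * t)) (at x)"
    unfolding r_fun_def s_def t_def using assms
    by (auto intro!: derivative_eq_intros simp: inverse_eq_divide)
  moreover have "1 / (2 * s) * t - s * - (1 / (2 * t)) = (s\<^sup>2 + t\<^sup>2) / (2 * (s * t))"
    using pos by (simp add: field_simps power2_eq_square)
  moreover have "1 - x\<^sup>2 = s\<^sup>2 * t\<^sup>2"
    unfolding sq by (simp add: power2_eq_square algebra_simps)
  moreover have "1 / (s * t) / (t * t) = s / t / (s\<^sup>2 * t\<^sup>2)"
    using pos by (simp add: field_simps power2_eq_square)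
  ultimately show ?thesis
    by (simp add: sq) (simp add: r_fun_def s_def t_def)
qed

lemma theta_power_r_fun:
  assumes "x \<in> {-1<..<1}"
  shows "(theta ^^ n) r_fun x = r_fun x * T_val n x / (1 - x\<^sup>2) ^ n"
  using assms
proof (induction n arbitrary: x)
  case (Suc n)
  let ?f = "\<lambda>x. r_fun x * T_val n x / (1 - x\<^sup>2) ^ n"
  have nz: "1 - x\<^sup>2 \<noteq> 0"
    using Suc.prems by (auto simp: power2_eq_1_iff)
  let ?q = "1 - x\<^sup>2" and ?T' = "poly (pderiv (real_poly (T_num n))) x"
  have pow: "((\<lambda>x. (1 - x\<^sup>2) ^ n) has_real_derivative - (2 * real n * x * ?q ^ n / ?q)) (at x)"
  proof -
    have "((\<lambda>x. (1 - x\<^sup>2) ^ n) has_real_derivative real n * ?q ^ (n - 1) * - (2 * x)) (at x)"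
      by (auto intro!: derivative_eq_intros)
    moreover have "real n * ?q ^ (n - 1) * - (2 * x) = - (2 * real n * x * ?q ^ n / ?q)"
      using nz by (cases n) simp_all
    ultimately show ?thesis
      by (simp only:)
  qed
  have quotient: "((r / q * T + T' * r) * Q - r * T * - (m * x * Q / q)) / (Q * Q) =
      r * ((1 + m * x) * T + q * T') / (q * Q)" if "q \<noteq> 0" "Q \<noteq> 0" for q Q r T T' m :: real
    using that by (simp add: field_simps)
  have "(?f has_real_derivative
      ((r_fun x / ?q * T_val n x + ?T' * r_fun x) * ?q ^ n -
        r_fun x * T_val n x * (- (2 * real n * x * ?q ^ n / ?q))) / (?q ^ n * ?q ^ n)) (at x)"
    using nz by (intro DERIV_divide DERIV_mult pow r_fun_has_derivative[OF Suc.prems] T_val_has_derivative) simp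
  then have "(?f has_real_derivative
      r_fun x * ((1 + real (2 * n) * x) * T_val n x + ?q * ?T') / ?q ^ Suc n) (at x)"
    by (rule DERIV_cong) (use quotient[of ?q "?q ^ n" "r_fun x" "T_val n x" ?T' "2 * real n"] nz in simp)
  then have "((theta ^^ n) r_fun has_real_derivative
      r_fun x * ((1 + real (2 * n) * x) * T_val n x + ?q * ?T') / ?q ^ Suc n) (at x)"
    by (rule has_field_derivative_transform_within_open[where S = "{-1<..<1}"])
      (use Suc in \<open>auto\<close>)
  then have "theta ((theta ^^ n) r_fun) x =
      x * (r_fun x * ((1 + real (2 * n) * x) * T_val n x + ?q * ?T') / ?q ^ Suc n)"
    by (simp add: theta_def DERIV_imp_deriv)
  also have "\<dots> = r_fun x * T_val (Suc n) x / ?q ^ Suc n"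
    unfolding T_val_Suc by (simp add: algebra_simps power2_eq_square)
  finally show ?case
    by simp
qed simp

lemma theta_power_denominator:
  assumes "x \<in> {-1<..<1}" "n \<ge> 1"
  shows "(1 - x) ^ n * (1 + x) ^ (n - 1) * sqrt (1 - x\<^sup>2) * r_fun x = (1 - x\<^sup>2) ^ n"
proof -
  have pos: "1 + x > 0" "1 - x > 0"
    using assms by auto
  have fac: "1 - x\<^sup>2 = (1 + x) * (1 - x)"
    by (simp add: power2_eq_square algebra_simps)
  have "sqrt (1 - x\<^sup>2) * r_fun x = 1 + x"
    using pos unfolding fac r_fun_def by (simp add: real_sqrt_mult)
  then have "(1 - x) ^ n * (1 + x) ^ (n - 1) * sqrt (1 - x\<^sup>2) * r_fun x = (1 - x) ^ n * (1 + x) ^ Suc (n - 1)"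
    by (simp add: mult.assoc mult.commute)
  also have "\<dots> = (1 - x\<^sup>2) ^ n"
    using \<open>n \<ge> 1\<close> by (simp add: fac power_mult_distrib mult.commute)
  finally show ?thesis .
qed

text \<open>
  The denominator in the definition of the coefficients equals \<open>(1 - x\<^sup>2) ^ n / r\<close>, so the prescribed
  form of the iterated derivative singles out the value of the numerator.
\<close>

lemma theta_power_r_fun_eq_iff:
  assumes "x \<in> {-1<..<1}" "n \<ge> 1"
  shows "(theta ^^ n) r_fun x = y / ((1 - x) ^ n * (1 + x) ^ (n - 1) * sqrt (1 - x\<^sup>2)) \<longleftrightarrow> y = T_val n x"
proof -
  have pos: "1 + x > 0" "1 - x > 0"
    using assms by auto
  then have "r_fun x > 0"
    by (simp add: r_fun_def)
  moreover have "1 - x\<^sup>2 = (1 + x) * (1 - x)"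
    by (simp add: power2_eq_square algebra_simps)
  then have "1 - x\<^sup>2 > 0"
    using pos by simp
  ultimately show ?thesis
    using pos assms unfolding theta_power_r_fun[OF assms(1)] theta_power_denominator[OF assms, symmetric]
    by (auto simp: divide_simps)
qed

lemma poly_finite_support:
  fixes p :: "'a::comm_semiring_1 poly"
  assumes "\<And>k. k \<notin> A \<Longrightarrow> coeff p k = 0" "finite A"
  shows "poly p x = (\<Sum>k\<in>A. coeff p k * x ^ k)"
proof -
  have "poly p x = (\<Sum>k\<in>{..degree p} \<union> A. coeff p k * x ^ k)"
    unfolding poly_altdef using assms(2) by (intro sum.mono_neutral_left) (auto simp: coeff_eq_0)
  also have "\<dots> = (\<Sum>k\<in>A. coeff p k * x ^ k)"
    using assms by (intro sum.mono_neutral_right) auto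
  finally show ?thesis .
qed

lemma poly_eq_if_eq_on_infinite:
  fixes p q :: "'a::idom poly"
  assumes "infinite S" "\<And>x. x \<in> S \<Longrightarrow> poly p x = poly q x"
  shows "p = q"
proof (rule ccontr)
  assume "p \<noteq> q"
  then have "finite {x. poly (p - q) x = 0}"
    by (intro poly_roots_finite) simp
  moreover have "S \<subseteq> {x. poly (p - q) x = 0}"
    using assms(2) by auto
  ultimately show False
    using assms(1) finite_subset by blast
qed

lemma is_T_coeffs_T_num: "is_T_coeffs (Suc n) (coeff (T_num (Suc n)))"
proof -
  have "T_val (Suc n) x = (\<Sum>k=1..2 * Suc n - 1. of_int (coeff (T_num (Suc n)) k) * x ^ k)" for x
    unfolding T_val_def
    by (subst poly_finite_support[where A = "{1..2 * Suc n - 1}"])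
      (simp_all add: coeff_map_poly coeff_T_num_outside)
  then show ?thesis
    unfolding is_T_coeffs_def
    by (intro conjI ballI allI impI coeff_T_num_pos coeff_T_num_outside
        theta_power_r_fun_eq_iff[THEN iffD2]) simp_all
qed

text \<open>
  A second coefficient family gives a polynomial with the same values on an interval, hence the same
  polynomial.
\<close>

lemma is_T_coeffs_unique:
  assumes "is_T_coeffs (Suc n) c"
  shows "c = coeff (T_num (Suc n))"
proof
  fix k
  define A where "A = {1..2 * Suc n - 1}"
  define p where "p = (\<Sum>k\<in>A. monom (c k) k)"
  have outside: "c k = 0" if "k \<notin> A" for k
    using assms that unfolding is_T_coeffs_def A_def by blast
  have theta_c: "(theta ^^ Suc n) r_fun x = (\<Sum>k\<in>A. of_int (c k) * x ^ k) /
      ((1 - x) ^ Suc n * (1 + x) ^ (Suc n - 1) * sqrt (1 - x\<^sup>2))" if "x \<in> {-1<..<1}" for x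
    using assms that unfolding is_T_coeffs_def A_def by blast
  have "finite A"
    by (simp add: A_def)
  then have coeff_p: "coeff p k = c k" for k
    using outside by (auto simp: p_def coeff_sum)
  have "poly (real_poly p) x = poly (real_poly (T_num (Suc n))) x" if x: "x \<in> {-1<..<1}" for x
  proof -
    have "poly (real_poly p) x = (\<Sum>k\<in>A. coeff (real_poly p) k * x ^ k)"
      using \<open>finite A\<close> by (intro poly_finite_support) (simp_all add: coeff_map_poly coeff_p outside)
    also have "\<dots> = (\<Sum>k\<in>A. of_int (c k) * x ^ k)"
      by (simp add: coeff_map_poly coeff_p)
    also have "\<dots> = T_val (Suc n) x"
      using theta_c[OF x] theta_power_r_fun_eq_iff[OF x, of "Suc n"] by (simp only: le_add1 plus_1_eq_Suc)
    finally show ?thesis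
      by (simp add: T_val_def)
  qed
  then have "real_poly p = real_poly (T_num (Suc n))"
    by (intro poly_eq_if_eq_on_infinite[where S = "{-1<..<1}"]) auto
  then have "coeff (real_poly p) k = coeff (real_poly (T_num (Suc n))) k"
    by simp
  then show "c k = coeff (T_num (Suc n)) k"
    by (simp add: coeff_map_poly coeff_p)
qed

lemma T_poly_eq_T_num: "T_poly n = T_num n"
proof (cases n)
  case (Suc m)
  have "T_coeff (Suc m) = coeff (T_num (Suc m))"
    unfolding T_coeff_def using is_T_coeffs_T_num is_T_coeffs_unique by blast
  then show ?thesis
    unfolding Suc T_poly_def using coeff_T_num_outside
    by (intro poly_eqI) (auto simp: coeff_sum)
qed (simp add: T_poly_def)

lemma theta_numerators_T_poly: "theta_numerators X T_poly"
  by (simp add: theta_numerators_def T_poly_eq_T_num T_num.simps)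

section \<open>The convolution identities\<close>

text \<open>
  The function \<open>\<theta> r = x / ((1 - x) sqrt (1 - x\<^sup>2))\<close> has logarithmic \<open>\<theta>\<close>-derivative
  \<open>(1 + x + x\<^sup>2) / (1 - x\<^sup>2)\<close>, and its iterated derivatives are those of \<open>r\<close> shifted by one.  In the
  recurrence, differentiating the factor \<open>X\<close> supplies \<open>1 - x\<^sup>2\<close> and the shift of \<open>n\<close> supplies
  \<open>2 x\<^sup>2\<close>.
\<close>

lemma T_poly_Suc_eq:
  assumes "theta_numerators (1 + X + X\<^sup>2) f"
  shows "T_poly (Suc n) = X * f n"
proof (induction n)
  case 0
  then show ?case
    using assms theta_numerators_T_poly by (simp add: theta_numerators_def)
next
  case (Suc n)
  have "T_poly (Suc (Suc n)) = (X + of_nat (2 * Suc n) * X\<^sup>2) * (X * f n) + euler_poly_op (X * f n)"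
    using theta_numerators_T_poly unfolding theta_numerators_def Suc.IH[symmetric] by blast
  also have "\<dots> = X * ((1 + X + X\<^sup>2 + of_nat (2 * n) * X\<^sup>2) * f n + euler_poly_op (f n))"
    unfolding euler_poly_op_mult by (simp add: euler_poly_op_def algebra_simps power2_eq_square)
  also have "\<dots> = X * f (Suc n)"
    using assms by (simp add: theta_numerators_def)
  finally show ?case .
qed

theorem corollary6:
  fixes n :: nat
  assumes "n \<ge> 1"
  shows "2 * [:1, 1:] ^ (n - 1) * eulerian_poly n =
           (\<Sum>k=0..n. of_nat (n choose k) * T_poly k * T_poly (n - k)) \<and>
         T_poly (n + 1) =
           [:0, 1:] * (\<Sum>k=0..n. of_nat (n choose k) * T_poly k * pcompose (B_poly (n - k)) ([:0, 1:]\<^sup>2)) \<and>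
         T_poly (n + 1) =
           [:0, 1:] * (\<Sum>k=0..n. of_nat (n choose k) * S_poly k * pcompose (N_poly (n - k)) ([:0, 1:]\<^sup>2))"
proof (intro conjI)
  have "theta_numerators (2 * X) (\<lambda>n. \<Sum>k=0..n. of_nat (n choose k) * T_poly k * T_poly (n - k))"
    using theta_numerators_convolution[OF theta_numerators_T_poly theta_numerators_T_poly] by simp
  moreover have "[:1, 1:] = 1 + X"
    by (simp add: X_def one_pCons)
  ultimately show "2 * [:1, 1:] ^ (n - 1) * eulerian_poly n =
      (\<Sum>k=0..n. of_nat (n choose k) * T_poly k * T_poly (n - k))"
    using theta_numerators_unique[OF theta_numerators_eulerian, of _ n] assms by simp
next
  have "theta_numerators (1 + X + X\<^sup>2)
      (\<lambda>n. \<Sum>k=0..n. of_nat (n choose k) * T_poly k * pcompose (B_poly (n - k)) ([:0, 1:]\<^sup>2))"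
    using theta_numerators_convolution[OF theta_numerators_T_poly theta_numerators_B_poly]
    by (simp only: ac_simps)
  then show "T_poly (n + 1) =
      [:0, 1:] * (\<Sum>k=0..n. of_nat (n choose k) * T_poly k * pcompose (B_poly (n - k)) ([:0, 1:]\<^sup>2))"
    using T_poly_Suc_eq by (simp only: Suc_eq_plus1[symmetric] X_def[symmetric])
next
  have "theta_numerators (1 + X + X\<^sup>2)
      (\<lambda>n. \<Sum>k=0..n. of_nat (n choose k) * S_poly k * pcompose (N_poly (n - k)) ([:0, 1:]\<^sup>2))"
    by (rule theta_numerators_convolution[OF theta_numerators_S_poly theta_numerators_N_poly])
  then show "T_poly (n + 1) =
      [:0, 1:] * (\<Sum>k=0..n. of_nat (n choose k) * S_poly k * pcompose (N_poly (n - k)) ([:0, 1:]\<^sup>2))"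
    using T_poly_Suc_eq by (simp only: Suc_eq_plus1[symmetric] X_def[symmetric])
qed

end
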